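(* We have $$1-\frac{\kappa}{2}=\mathbb P\big(\overline{L_0}\big)=\frac34+\sum_{k\ge1}\ \sum_{P\in\mathcal P_k}\mathbb P(P_0=P).$$
   Context: Infinite noodle: let $\boldsymbol w^a_\infty,\boldsymbol w^b_\infty\in\{L,R\}^{\mathbb Z}$ be two independent random words with i.i.d. uniform letters in $\{L,R\}$. Almost surely there is a unique non-crossing partition of $\mathbb Z$ into pairs (no two pairs $\{i,k\},\{j,\ell\}$ with $i<j<k<\ell$) such that, for all $i$, $i$ is the smaller element of its pair iff $\boldsymbol w^a_\infty(i)=L$ (upper matching), and similarly for $\boldsymbol w^b_\infty$ (lower matching). The infinite noodle $\boldsymbol M_\infty$ consists of these two matchings, viewed as a (multi-)graph on $\mathbb Z$; $C_0(\boldsymbol M_\infty)$ is the component of $0$ and $\kappa=\mathbb E[2/|C_0(\boldsymbol M_\infty)|]$, with $2/\infty=0$. Partial meandric systems: for an integer interval $A$, a partial matching on $A$ is a partition of $A$ into pairs and singletons, each singleton decorated with $L$ or $R$. It is non-crossing if it contains none of: two pairs $\{i,k\},\{j,\ell\}$ with $i<j<k<\ell$; a pair $\{i,k\}$ and a singleton $\{j\}$ with $i<j<k$; two singletons $\{i\},\{j\}$ with $i<j$, $i$ decorated $L$, $j$ decorated $R$. It is encoded by the word $w\in\{L,R\}^A$ with $w(i)=L$ iff $\{i\}$ is a singleton decorated $L$ or $i$ is the smaller element of its pair; this is a bijection between non-crossing partial matchings on $A$ and $\{L,R\}^A$. A partial meandric system on $A$ is an ordered pair (upper, lower) of non-crossing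 partial matchings on $A$; its connected components are those of the multigraph on $A$ formed by the pairs of both. A partial meander is a partial meandric system with only one connected component. The restriction to a subinterval $B$ keeps pairs and decorated singletons inside $B$, and turns each $i\in B$ paired with $i'\notin B$ into a singleton decorated $L$ if $i'>i$, $R$ if $i'<i$; it is denoted $M/B$. Events: $L_0$ is the event that $0$ is the leftmost point of $C_0(\boldsymbol M_\infty)$, and $\overline{L_0}$ is its complement. For $k\ge0$, $E_k$ is the event that $0$ is not the leftmost point of its connected component in the restriction of $\boldsymbol M_\infty$ to $(-\infty,k]$ (i.e. one of the paths starting from $0$ visits $(-\infty,-1]$ before visiting $[k+1,+\infty)$). One has $\overline{L_0}=\bigcup_{k\ge0}E_k$; on $\overline{L_0}$ set $K=\inf\{k\ge0: E_k \text{ holds}\}$. Partial shape: on $\overline{L_0}\cap\{K\ge1\}$, let $E$ be the set of points of the connected component of $0$ in $\boldsymbol M_\infty/\{0,\dots,K\}$, and $g:E\to\{0,\dots,|E|-1\}$ the increasing bijection. The partial shape $P_0$ is the partial meandric system on $\{0,\dots,|E|-1\}$ with upper and lower words $\boldsymbol w^a(i)=\boldsymbol w^a_\infty(g^{-1}(i))$, $\boldsymbol w^b(i)=\boldsymbol w^b_\infty(g^{-1}(i))$. The event $\{P_0=P\}$ includes that $\overline{L_0}$ holds and $K\ge1$. The set $\mathcal P_k$ ($k\ge1$): the set of partial meanders $P$ on $\{0,\dots,2k\}$ such that (i) the restriction of $P$ to $\{0,\dots,2k-1\}$ does not have $0$ and a singleton decorated $R$ in the same connected component; (ii) each of the upper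 and lower partial matchings of $P$ has exactly one singleton, one of these two singletons being decorated $L$ and the other $R$. (The number of points, $2k+1$, is odd.) *)

theory Defs
  imports "HOL-Probability.Probability" "HOL-Library.Disjoint_Sets"
begin

datatype letter = L | R

text \<open>The domain of \<^emph>\<open>deco\<close> is the set of singletons, its values are their decorations.\<close>

record partial_matching =
  pairs :: "int set set"
  deco :: "int \<rightharpoonup> letter"

definition partial_matching_on :: "int set \<Rightarrow> partial_matching \<Rightarrow> bool" where
  "partial_matching_on A m \<longleftrightarrow>
     partition_on A (pairs m \<union> (\<lambda>i. {i}) ` dom (deco m)) \<and> (\<forall>p\<in>pairs m. card p = 2)"

definition noncrossing :: "partial_matching \<Rightarrow> bool" where
  "noncrossing m \<longleftrightarrow>
     \<not> (\<exists>i j k l. i < j \<and> j < k \<and> k < l \<and> {i, k} \<in> pairs m \<and> {j, l} \<in> pairs m) \<and>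
     \<not> (\<exists>i j k. i < j \<and> j < k \<and> {i, k} \<in> pairs m \<and> j \<in> dom (deco m)) \<and>
     \<not> (\<exists>i j. i < j \<and> deco m i = Some L \<and> deco m j = Some R)"

definition word_of :: "partial_matching \<Rightarrow> int \<Rightarrow> letter" where
  "word_of m i = (if deco m i = Some L \<or> (\<exists>k>i. {i, k} \<in> pairs m) then L else R)"

definition encoded_by :: "int set \<Rightarrow> partial_matching \<Rightarrow> (int \<Rightarrow> letter) \<Rightarrow> bool" where
  "encoded_by A m w \<longleftrightarrow>
     partial_matching_on A m \<and> noncrossing m \<and> (\<forall>i\<in>A. word_of m i = w i)"

text \<open>The encoding is a bijection between non-crossing partial matchings on an integer interval
  \<open>A\<close> and words on \<open>A\<close>, so the description below denotes the unique matching; it only depends on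
  the values of \<open>w\<close> on \<open>A\<close>.\<close>

definition matching_of_word :: "int set \<Rightarrow> (int \<Rightarrow> letter) \<Rightarrow> partial_matching" where
  "matching_of_word A w = (THE m. encoded_by A m w)"

definition restrict_matching :: "partial_matching \<Rightarrow> int set \<Rightarrow> partial_matching" where
  "restrict_matching m B =
     \<lparr>pairs = {p \<in> pairs m. p \<subseteq> B},
      deco = (\<lambda>i.
        if i \<notin> B then None
        else if i \<in> dom (deco m) then deco m i
        else if \<exists>i'. i' \<notin> B \<and> i < i' \<and> {i, i'} \<in> pairs m then Some L
        else if \<exists>i'. i' \<notin> B \<and> i' < i \<and> {i, i'} \<in> pairs m then Some R
        else None)\<rparr>"

type_synonym meandric_system = "partial_matching \<times> partial_matching"

definition partial_meandric_system_on :: "int set \<Rightarrow> meandric_system \<Rightarrow> bool" where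
  "partial_meandric_system_on A M \<longleftrightarrow>
     partial_matching_on A (fst M) \<and> noncrossing (fst M) \<and>
     partial_matching_on A (snd M) \<and> noncrossing (snd M)"

text \<open>Multiplicities of edges are irrelevant for connectedness, so components are taken in the
  union of the two sets of pairs.\<close>

definition component :: "meandric_system \<Rightarrow> int \<Rightarrow> int set" where
  "component M i = {j. (i, j) \<in> {(x, y). {x, y} \<in> pairs (fst M) \<union> pairs (snd M)}\<^sup>*}"

definition leftmost :: "meandric_system \<Rightarrow> int \<Rightarrow> bool" where
  "leftmost M i \<longleftrightarrow> (\<forall>j\<in>component M i. i \<le> j)"

definition restrict_system :: "meandric_system \<Rightarrow> int set \<Rightarrow> meandric_system" where
  "restrict_system M B = (restrict_matching (fst M) B, restrict_matching (snd M) B)"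

definition partial_meander_on :: "int set \<Rightarrow> meandric_system \<Rightarrow> bool" where
  "partial_meander_on A M \<longleftrightarrow> partial_meandric_system_on A M \<and> card (component M ` A) = 1"

text \<open>Below, \<open>deco (fst P) = [i \<mapsto> a]\<close> says that \<open>{i}\<close> is the only singleton of the upper matching
  and that it is decorated \<open>a\<close>.\<close>

definition partial_shapes :: "nat \<Rightarrow> meandric_system set" where
  "partial_shapes k =
     {P. partial_meander_on {0..2 * int k} P \<and>
         (let Q = restrict_system P {0..2 * int k - 1} in
            \<not> (\<exists>j\<in>component Q 0. deco (fst Q) j = Some R \<or> deco (snd Q) j = Some R)) \<and>
         (\<exists>i j a b. deco (fst P) = [i \<mapsto> a] \<and> deco (snd P) = [j \<mapsto> b] \<and> {a, b} = {L, R})}"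

lemma finite_partial_matchings_on:
  assumes "finite A"
  shows "finite {m. partial_matching_on A m}"
proof (rule finite_subset)
  let ?D = "\<Union>B\<in>Pow A. {d. dom d = B \<and> ran d \<subseteq> (UNIV :: letter set)}"
  have "(UNIV :: letter set) = {L, R}"
    using letter.exhaust by auto
  then have "finite (UNIV :: letter set)"
    by (metis finite.emptyI finite.insertI)
  then have "finite {d. dom d = B \<and> ran d \<subseteq> (UNIV :: letter set)}" if "B \<in> Pow A" for B
    using finite_set_of_finite_maps[OF finite_subset[of B A]] that assms by blast
  then have D: "finite ?D"
    using assms by (intro finite_UN_I) simp_all
  show "finite ((\<lambda>(p, d). \<lparr>pairs = p, deco = d\<rparr>) ` (Pow (Pow A) \<times> ?D))"
    using assms D by blast
  show "{m. partial_matching_on A m} \<subseteq>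
      (\<lambda>(p, d). \<lparr>pairs = p, deco = d\<rparr>) ` (Pow (Pow A) \<times> ?D)"
  proof
    fix m :: partial_matching
    assume "m \<in> {m. partial_matching_on A m}"
    then have "\<Union>(pairs m \<union> (\<lambda>i. {i}) ` dom (deco m)) = A"
      by (simp add: partial_matching_on_def partition_on_def)
    then have "pairs m \<in> Pow (Pow A)" and "deco m \<in> ?D" by auto
    moreover have "m = (\<lambda>(p, d). \<lparr>pairs = p, deco = d\<rparr>) (pairs m, deco m)" by simp
    ultimately show "m \<in> (\<lambda>(p, d). \<lparr>pairs = p, deco = d\<rparr>) ` (Pow (Pow A) \<times> ?D)"
      by blast
  qed
qed

lemma finite_partial_shapes: "finite (partial_shapes k)"
proof (rule finite_subset)
  show "partial_shapes k \<subseteq> {m. partial_matching_on {0..2 * int k} m} \<times>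
      {m. partial_matching_on {0..2 * int k} m}"
    by (auto simp: partial_shapes_def partial_meander_on_def partial_meandric_system_on_def)
qed (simp add: finite_partial_matchings_on)

definition perfect_matching_of :: "(int \<Rightarrow> letter) \<Rightarrow> partial_matching \<Rightarrow> bool" where
  "perfect_matching_of w m \<longleftrightarrow> encoded_by UNIV m w \<and> deco m = Map.empty"

text \<open>For a random word a unique perfect matching exists almost surely; on the exceptional null
  event the matching without edges is used, which keeps the events below measurable.\<close>

definition noodle_matching :: "(int \<Rightarrow> letter) \<Rightarrow> partial_matching" where
  "noodle_matching w =
     (if \<exists>!m. perfect_matching_of w m then THE m. perfect_matching_of w m
      else \<lparr>pairs = {}, deco = Map.empty\<rparr>)"

definition noodle :: "(int \<Rightarrow> letter) \<Rightarrow> (int \<Rightarrow> letter) \<Rightarrow> meandric_system" where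
  "noodle u v = (noodle_matching u, noodle_matching v)"

definition L0 :: "(int \<Rightarrow> letter) \<Rightarrow> (int \<Rightarrow> letter) \<Rightarrow> bool" where
  "L0 u v \<longleftrightarrow> leftmost (noodle u v) 0"

definition E_event :: "nat \<Rightarrow> (int \<Rightarrow> letter) \<Rightarrow> (int \<Rightarrow> letter) \<Rightarrow> bool" where
  "E_event k u v \<longleftrightarrow> \<not> leftmost (restrict_system (noodle u v) {..int k}) 0"

text \<open>Only meaningful when \<open>\<not> L0 u v\<close>, in which case the set below is nonempty.\<close>

definition first_K :: "(int \<Rightarrow> letter) \<Rightarrow> (int \<Rightarrow> letter) \<Rightarrow> nat" where
  "first_K u v = Inf {k. E_event k u v}"

definition explored_points :: "(int \<Rightarrow> letter) \<Rightarrow> (int \<Rightarrow> letter) \<Rightarrow> int set" where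
  "explored_points u v = component (restrict_system (noodle u v) {0..int (first_K u v)}) 0"

text \<open>If \<open>g\<close> is the increasing bijection from the finite set \<open>S\<close> onto \<open>{0..<card S}\<close>, then
  \<open>relabel S w\<close> is \<open>w\<close> composed with the inverse of \<open>g\<close>.\<close>

definition relabel :: "int set \<Rightarrow> (int \<Rightarrow> letter) \<Rightarrow> int \<Rightarrow> letter" where
  "relabel S w i = w (sorted_list_of_set S ! nat i)"

definition partial_shape :: "(int \<Rightarrow> letter) \<Rightarrow> (int \<Rightarrow> letter) \<Rightarrow> meandric_system" where
  "partial_shape u v =
     (let S = explored_points u v; A = {0..<int (card S)}
      in (matching_of_word A (relabel S u), matching_of_word A (relabel S v)))"

definition has_partial_shape ::
    "(int \<Rightarrow> letter) \<Rightarrow> (int \<Rightarrow> letter) \<Rightarrow> meandric_system \<Rightarrow> bool" where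
  "has_partial_shape u v P \<longleftrightarrow> \<not> L0 u v \<and> first_K u v \<ge> 1 \<and> partial_shape u v = P"

definition iid_uniform_words ::
    "'a measure \<Rightarrow> ('a \<Rightarrow> int \<Rightarrow> letter) \<Rightarrow> ('a \<Rightarrow> int \<Rightarrow> letter) \<Rightarrow> bool" where
  "iid_uniform_words M wa wb \<longleftrightarrow>
     prob_space.indep_vars M (\<lambda>_. count_space UNIV)
       (case_sum (\<lambda>i \<omega>. wa \<omega> i) (\<lambda>i \<omega>. wb \<omega> i)) UNIV \<and>
     (\<forall>i l. \<P>(\<omega> in M. wa \<omega> i = l) = 1 / 2 \<and> \<P>(\<omega> in M. wb \<omega> i = l) = 1 / 2)"

definition kappa :: "'a measure \<Rightarrow> ('a \<Rightarrow> int \<Rightarrow> letter) \<Rightarrow> ('a \<Rightarrow> int \<Rightarrow> letter) \<Rightarrow> real" where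
  "kappa M wa wb =
     (LINT \<omega>|M. (let C = component (noodle (wa \<omega>) (wb \<omega>)) 0
                 in if finite C then 2 / real (card C) else 0))"

end

(* If the leftmost point of each finite component C sends mass 1/|C| to every point of C, translation
   invariance gives P(L0) = E[1/|C_0|] = kappa/2. An infinite component with a leftmost point would
   let that point send infinite total mass while each point receives a bounded one, so almost surely
   there is none.

   On the complement of L0, K = 0 means that one of the two letters at 0 is R, which has probability
   3/4. For K >= 1, let D be the component of 0 in {0..K-1} and S the one in {0..K}. Each of them is
   a path with exactly two exits. The exits of D lead to K and beyond K, and those of S lead beyond K
   and to the left of 0. A parity argument on the points of S - D below the arcs between points of D
   shows that the two exits of D are on the same side of the line, those of S on opposite sides, and
   that |S| is odd; so the partial shape lies in one of the disjoint sets partial_shapes k. *)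

theory Submission
  imports Defs
begin

section \<open>Words and non-crossing matchings\<close>

text \<open>The matchings are given by descriptions, which cannot be computed with directly. They
  are replaced throughout by the explicit relation \<open>mate\<close>: letters are the steps of a
  walk, and an arc joins a point to the first return of the walk. Whether two points are mates
  depends only on the letters from one to the other, so the events in question become countable
  combinations of events about finitely many letters. Uniqueness of the encoding identifies the
  described matchings with this model, also after restriction and relabelling. A perfect matching
  exists iff every point has a mate, which holds almost surely because simple random walk returns to
  its starting height. Off a null event only two non-crossing involutions without fixed points
  remain, and the exploration up to \<open>K\<close> is a deterministic statement about them.
  Probabilities are computed on one product space, on which translations act, and are carried over
  at the end to the given words. Infinite components get the prescribed value in
  \<open>kappa\<close> automatically: their cardinality is \<open>0\<close>, and
  \<open>1 / 0 = 0\<close>.\<close>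

definition step :: "letter \<Rightarrow> int" where
  "step l = (if l = L then 1 else -1)"

definition height :: "(int \<Rightarrow> letter) \<Rightarrow> int \<Rightarrow> int \<Rightarrow> int" where
  "height w i k = (\<Sum>j\<in>{i..k}. step (w j))"

text \<open>An arc is an excursion: \<open>k\<close> is where the walk first returns to the height
  it had just before \<open>i\<close>. Positivity already at \<open>j = i\<close> forces the letter
  \<open>L\<close> there, and only letters on \<open>{i..k}\<close> are read.\<close>

definition matched :: "(int \<Rightarrow> letter) \<Rightarrow> int \<Rightarrow> int \<Rightarrow> bool" where
  "matched w i k \<longleftrightarrow> i < k \<and> height w i k = 0 \<and> (\<forall>j. i \<le> j \<and> j < k \<longrightarrow> height w i j > 0)"

lemma step_simps [simp]: "step L = 1" "step R = -1"
  by (simp_all add: step_def)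

lemma not_L_iff [simp]: "l \<noteq> L \<longleftrightarrow> l = R"
  by (cases l) auto

lemma not_R_iff [simp]: "l \<noteq> R \<longleftrightarrow> l = L"
  by (cases l) auto

lemma height_empty: "k < i \<Longrightarrow> height w i k = 0"
  by (simp add: height_def)

lemma height_single [simp]: "height w i i = step (w i)"
  by (simp add: height_def)

lemma height_split:
  assumes "i \<le> j" "j \<le> k + 1"
  shows "height w i k = height w i (j - 1) + height w j k"
proof -
  have "{i..k} = {i..j - 1} \<union> {j..k}" using assms by auto
  moreover have "{i..j - 1} \<inter> {j..k} = {}" by auto
  ultimately show ?thesis unfolding height_def by (simp add: sum.union_disjoint)
qed

lemma height_last: "i \<le> k \<Longrightarrow> height w i k = height w i (k - 1) + step (w k)"
  using height_split[of i k k w] by simp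

lemma height_first: "i \<le> k \<Longrightarrow> height w i k = step (w i) + height w (i + 1) k"
  using height_split[of i "i + 1" k w] by simp

lemma height_cong: "(\<And>j. i \<le> j \<Longrightarrow> j \<le> k \<Longrightarrow> w j = w' j) \<Longrightarrow> height w i k = height w' i k"
  unfolding height_def by (intro sum.cong) auto

lemma matched_cong:
  assumes "\<And>j. i \<le> j \<Longrightarrow> j \<le> k \<Longrightarrow> w j = w' j"
  shows "matched w i k = matched w' i k"
proof -
  have "height w i j = height w' i j" if "j \<le> k" for j
    using that assms by (intro height_cong) auto
  then show ?thesis unfolding matched_def by auto
qed

lemma matched_less: "matched w i k \<Longrightarrow> i < k"
  by (simp add: matched_def)

text \<open>An excursion read backwards: the total is 0 and every proper prefix is positive, so
  every proper suffix is negative.\<close>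

lemma matched_suffix:
  assumes "matched w i k" "i < j" "j \<le> k"
  shows "height w j k < 0"
proof -
  have "height w i (j - 1) > 0" "height w i k = 0"
    using assms by (auto simp: matched_def)
  then show ?thesis using height_split[of i j k w] assms by simp
qed

lemma matched_left_letter: "matched w i k \<Longrightarrow> w i = L"
  unfolding matched_def by (cases "w i") (auto dest!: spec[of _ i])

lemma matched_right_letter: "matched w i k \<Longrightarrow> w k = R"
  using matched_suffix[of w i k k] by (cases "w k") (auto simp: matched_def)

lemma matched_right_unique:
  assumes "matched w i k" "matched w i k'"
  shows "k = k'"
proof (rule ccontr)
  assume "k \<noteq> k'"
  then consider "k < k'" | "k' < k" by linarith
  then show False
    using assms unfolding matched_def by cases (metis less_irrefl less_imp_le)+
qed

lemma matched_left_unique: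
  assumes "matched w i k" "matched w i' k"
  shows "i = i'"
proof (rule ccontr)
  assume "i \<noteq> i'"
  then consider "i < i'" | "i' < i" by linarith
  then show False
    using assms matched_suffix[of w i k i'] matched_suffix[of w i' k i]
    by cases (auto simp: matched_def)
qed

text \<open>If the second arc reached past \<open>k\<close>, the heights of
  \<open>{i..j - 1}\<close> and \<open>{j..k}\<close> would both be positive, although they add up
  to the height 0 of the first arc.\<close>

lemma matched_noncrossing:
  assumes "matched w i k" "matched w j l" "i < j" "j < k"
  shows "l < k"
proof (rule ccontr)
  assume "\<not> l < k"
  then consider "k = l" | "k < l" by linarith
  then show False
  proof cases
    case 1
    then show False using matched_left_unique assms by auto
  next
    case 2
    then have "height w j k > 0" "height w i (j - 1) > 0" "height w i k = 0"
      using assms by (auto simp: matched_def)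
    then show False using height_split[of i j k w] assms by simp
  qed
qed

text \<open>Discrete intermediate values: the steps are \<open>1\<close> or \<open>-1\<close>, so at
  the least time when the height is no longer positive it is exactly 0.\<close>

lemma ex_matched_right:
  assumes "w i = L" "i \<le> t" "height w i t \<le> 0"
  shows "\<exists>k\<le>t. matched w i k"
proof -
  let ?P = "\<lambda>n. height w i (i + int n) \<le> 0"
  have "?P (nat (t - i))" using assms by simp
  then obtain n where n: "n \<le> nat (t - i)" "?P n" "\<forall>m<n. \<not> ?P m"
    using ex_least_nat_le[of ?P] by blast
  have "n \<noteq> 0" using n(2) assms(1) by (intro notI) simp
  have pos: "height w i j > 0" if "i \<le> j" "j < i + int n" for j
  proof -
    have "nat (j - i) < n" using that by linarith
    then show ?thesis using n(3) that by fastforce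
  qed
  have "height w i (i + int n) = height w i (i + int n - 1) + step (w (i + int n))"
    by (rule height_last) simp
  moreover have "height w i (i + int n - 1) > 0" using \<open>n \<noteq> 0\<close> by (intro pos) auto
  moreover have "step (w (i + int n)) \<ge> -1" by (simp add: step_def)
  ultimately have "height w i (i + int n) = 0" using n(2) by linarith
  then have "matched w i (i + int n)" unfolding matched_def using pos \<open>n \<noteq> 0\<close> by auto
  moreover have "i + int n \<le> t" using n(1) assms(2) by linarith
  ultimately show ?thesis by blast
qed

lemma ex_matched_left:
  assumes "w k = R" "t \<le> k" "height w t k \<ge> 0"
  shows "\<exists>i\<ge>t. matched w i k"
proof -
  let ?P = "\<lambda>n. height w (k - int n) k \<ge> 0"
  have "?P (nat (k - t))" using assms by simp
  then obtain n where n: "n \<le> nat (k - t)" "?P n" "\<forall>m<n. \<not> ?P m"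
    using ex_least_nat_le[of ?P] by blast
  let ?i = "k - int n"
  have "n \<noteq> 0" using n(2) assms(1) by (intro notI) simp
  have neg: "height w j k < 0" if "?i < j" "j \<le> k" for j
  proof -
    have "nat (k - j) < n" using that by linarith
    then show ?thesis using n(3) that by fastforce
  qed
  have "height w ?i k = step (w ?i) + height w (?i + 1) k"
    by (rule height_first) simp
  moreover have "height w (?i + 1) k < 0" using \<open>n \<noteq> 0\<close> by (intro neg) auto
  moreover have "step (w ?i) \<le> 1" by (simp add: step_def)
  ultimately have 0: "height w ?i k = 0" using n(2) by linarith
  have "height w ?i j > 0" if "?i \<le> j" "j < k" for j
    using height_split[of ?i "j + 1" k w] neg[of "j + 1"] that 0 by simp
  then have "matched w ?i k" unfolding matched_def using 0 \<open>n \<noteq> 0\<close> by auto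
  moreover have "t \<le> ?i" using n(1) assms(2) by linarith
  ultimately show ?thesis by blast
qed

lemma matched_between_L:
  assumes "matched w i k" "i < j" "j < k" "w j = L"
  shows "\<exists>l. matched w j l \<and> l < k"
proof -
  have "height w j k \<le> 0" using matched_suffix[of w i k j] assms by simp
  then obtain l where "matched w j l" using ex_matched_right[of w j k] assms by auto
  then show ?thesis using matched_noncrossing assms by blast
qed

lemma matched_between_R:
  assumes "matched w i k" "i < j" "j < k" "w j = R"
  shows "\<exists>l. matched w l j \<and> i < l"
proof -
  have "height w i j \<ge> 0" using assms unfolding matched_def by (simp add: less_imp_le)
  then obtain l where l: "matched w l j" "i \<le> l" using ex_matched_left[of w j i] assms by auto
  then have "l \<noteq> i" using matched_right_unique assms by blast
  then show ?thesis using l by auto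
qed

definition mate :: "(int \<Rightarrow> letter) \<Rightarrow> int \<Rightarrow> int \<Rightarrow> bool" where
  "mate w i j \<longleftrightarrow> matched w i j \<or> matched w j i"

lemma mate_sym: "mate w i j \<longleftrightarrow> mate w j i"
  by (auto simp: mate_def)

lemma mate_unique: "mate w i j \<Longrightarrow> mate w i j' \<Longrightarrow> j = j'"
  unfolding mate_def
  by (metis matched_right_unique matched_left_unique matched_left_letter matched_right_letter
      letter.distinct(1))

lemma mate_irrefl [simp]: "\<not> mate w i i"
  by (simp add: mate_def matched_def)

lemma mate_less: "mate w i j \<Longrightarrow> i < j \<longleftrightarrow> w i = L"
  unfolding mate_def using matched_less matched_left_letter matched_right_letter
  by (metis letter.distinct(1) less_asym)

lemma mate_between:
  assumes "mate w i k" "i < j" "j < k"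
  shows "\<exists>l. mate w j l \<and> i < l \<and> l < k"
proof -
  have m: "matched w i k" using assms by (auto simp: mate_def dest: matched_less)
  show ?thesis
  proof (cases "w j")
    case L
    with matched_between_L[OF m assms(2,3)] obtain l where "matched w j l" "l < k" by blast
    then show ?thesis using assms matched_less[of w j l] by (auto simp: mate_def)
  next
    case R
    with matched_between_R[OF m assms(2,3)] obtain l where "matched w l j" "i < l" by blast
    then show ?thesis using assms matched_less[of w l j] by (auto simp: mate_def)
  qed
qed

text \<open>The sign of the height of \<open>{i..j}\<close> decides which of the two letters finds
  its mate inside. This is what forbids an unmatched \<open>L\<close> to the left of an unmatched
  \<open>R\<close>.\<close>

lemma unmatched_L_before_R:
  assumes "i < j" "w i = L" "w j = R"
  shows "(\<exists>k\<le>j. matched w i k) \<or> (\<exists>k\<ge>i. matched w k j)"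
proof (cases "height w i j \<le> 0")
  case True
  then show ?thesis using ex_matched_right[of w i j] assms by auto
next
  case False
  then show ?thesis using ex_matched_left[of w j i] assms by auto
qed

section \<open>Encoding of partial matchings by words\<close>

definition matching_of_relation ::
    "int set \<Rightarrow> (int \<Rightarrow> int \<Rightarrow> bool) \<Rightarrow> (int \<Rightarrow> letter) \<Rightarrow> partial_matching" where
  "matching_of_relation A r w =
     \<lparr>pairs = {{i, k} |i k. i \<in> A \<and> k \<in> A \<and> r i k},
      deco = (\<lambda>i. if i \<in> A \<and> \<not> (\<exists>k\<in>A. r i k) then Some (w i) else None)\<rparr>"

lemma pairs_matching_of_relation:
  assumes "\<And>i k. r i k \<Longrightarrow> r k i"
  shows "{i, k} \<in> pairs (matching_of_relation A r w) \<longleftrightarrow> i \<in> A \<and> k \<in> A \<and> r i k"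
  using assms by (auto simp: matching_of_relation_def doubleton_eq_iff)

lemma deco_matching_of_relation:
  "deco (matching_of_relation A r w) i = (if i \<in> A \<and> \<not> (\<exists>k\<in>A. r i k) then Some (w i) else None)"
  by (simp add: matching_of_relation_def)

lemma partial_matching_on_matching_of_relation:
  assumes sym: "\<And>i k. r i k \<Longrightarrow> r k i" and irrefl: "\<And>i. \<not> r i i"
    and unique: "\<And>i k k'. r i k \<Longrightarrow> r i k' \<Longrightarrow> k = k'"
  shows "partial_matching_on A (matching_of_relation A r w)"
proof -
  let ?m = "matching_of_relation A r w"
  have pairs_r: "{i, k} \<in> pairs ?m \<longleftrightarrow> i \<in> A \<and> k \<in> A \<and> r i k" for i k
    by (rule pairs_matching_of_relation) (rule sym)
  let ?S = "(\<lambda>i. {i}) ` dom (deco ?m)"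
  have pform: "\<exists>i k. p = {i, k} \<and> i \<in> A \<and> k \<in> A \<and> r i k" if "p \<in> pairs ?m" for p
    using that unfolding matching_of_relation_def by auto
  have dom: "i \<in> dom (deco ?m) \<longleftrightarrow> i \<in> A \<and> \<not> (\<exists>k\<in>A. r i k)" for i
    by (auto simp: deco_matching_of_relation split: if_splits)
  have "partition_on A (pairs ?m \<union> ?S)"
  proof (rule partition_onI)
    show "\<Union> (pairs ?m \<union> ?S) = A"
    proof (intro equalityI subsetI)
      fix i assume "i \<in> \<Union> (pairs ?m \<union> ?S)"
      then show "i \<in> A" using pform dom by fastforce
    next
      fix i assume i: "i \<in> A"
      show "i \<in> \<Union> (pairs ?m \<union> ?S)"
      proof (cases "\<exists>k\<in>A. r i k")
        case True
        then obtain k where "k \<in> A" "r i k" by blast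
        then have "{i, k} \<in> pairs ?m" using i by (simp add: pairs_r)
        then show ?thesis by blast
      next
        case False
        then have "{i} \<in> ?S" using i dom[of i] by (intro imageI) blast
        then show ?thesis by blast
      qed
    qed
    fix p q assume pq: "p \<in> pairs ?m \<union> ?S" "q \<in> pairs ?m \<union> ?S" "p \<noteq> q"
    have key: "p = q" if "p \<in> pairs ?m \<union> ?S" "q \<in> pairs ?m \<union> ?S" "x \<in> p" "x \<in> q" for p q x
    proof -
      have form: "(\<exists>k\<in>A. r x k \<and> p = {x, k}) \<or> (p = {x} \<and> \<not> (\<exists>k\<in>A. r x k))"
        if "p \<in> pairs ?m \<union> ?S" "x \<in> p" for p
      proof (cases "p \<in> pairs ?m")
        case True
        then show ?thesis using pform[OF True] that sym by blast
      next
        case False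
        then show ?thesis using that dom by auto
      qed
      from form[OF that(1,3)] form[OF that(2,4)] show ?thesis
        using unique by blast
    qed
    show "disjnt p q" unfolding disjnt_def using key[OF pq(1,2)] pq(3) by blast
  next
    show "{} \<notin> pairs ?m \<union> ?S" using pform by fastforce
  qed
  moreover have "card p = 2" if p: "p \<in> pairs ?m" for p
  proof -
    obtain i k where "p = {i, k}" "r i k" using pform[OF p] by blast
    moreover then have "i \<noteq> k" using irrefl by auto
    ultimately show ?thesis by simp
  qed
  ultimately show ?thesis unfolding partial_matching_on_def by blast
qed

definition interval :: "int set \<Rightarrow> bool" where
  "interval A \<longleftrightarrow> (\<forall>i\<in>A. \<forall>k\<in>A. {i..k} \<subseteq> A)"

lemma interval_simps [simp]: "interval UNIV" "interval {a..b}" "interval {..b}" "interval {a..<b}"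
  by (auto simp: interval_def)

text \<open>Stated for an arbitrary relation because it serves twice: for \<open>mate\<close>
  itself, and for the mates within a subset of points transported to consecutive labels. The nesting
  hypothesis excludes both crossings and singletons under an arc.\<close>

lemma encoded_by_matching_of_relation:
  assumes A: "interval A"
    and sym: "\<And>i k. r i k \<Longrightarrow> r k i" and irrefl: "\<And>i. \<not> r i i"
    and unique: "\<And>i k k'. r i k \<Longrightarrow> r i k' \<Longrightarrow> k = k'"
    and less_iff: "\<And>i k. i \<in> A \<Longrightarrow> k \<in> A \<Longrightarrow> r i k \<Longrightarrow> i < k \<longleftrightarrow> w i = L"
    and nested: "\<And>i j k. i \<in> A \<Longrightarrow> k \<in> A \<Longrightarrow> r i k \<Longrightarrow> i < j \<Longrightarrow> j < k \<Longrightarrow> \<exists>l. r j l \<and> i < l \<and> l < k"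
    and L_before_R: "\<And>i j. i \<in> A \<Longrightarrow> j \<in> A \<Longrightarrow> i < j \<Longrightarrow> w i = L \<Longrightarrow> w j = R \<Longrightarrow>
      (\<exists>k\<in>A. r i k) \<or> (\<exists>k\<in>A. r j k)"
  shows "encoded_by A (matching_of_relation A r w) w"
proof -
  let ?m = "matching_of_relation A r w"
  have pairs_r: "{i, k} \<in> pairs ?m \<longleftrightarrow> i \<in> A \<and> k \<in> A \<and> r i k" for i k
    by (rule pairs_matching_of_relation) (rule sym)
  have mem: "j \<in> A" if "i \<in> A" "k \<in> A" "i \<le> j" "j \<le> k" for i j k
    using A that unfolding interval_def by (meson atLeastAtMost_iff subsetD)
  have "\<not> (\<exists>i j k l. i < j \<and> j < k \<and> k < l \<and> {i, k} \<in> pairs ?m \<and> {j, l} \<in> pairs ?m)"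
  proof safe
    fix i j k l assume *: "i < j" "j < k" "k < l" "{i, k} \<in> pairs ?m" "{j, l} \<in> pairs ?m"
    then obtain l' where "r j l'" "l' < k" using nested[of i k j] unfolding pairs_r by blast
    moreover have "r j l" using * unfolding pairs_r by blast
    ultimately show False using unique[of j l l'] * by simp
  qed
  moreover have "\<not> (\<exists>i j k. i < j \<and> j < k \<and> {i, k} \<in> pairs ?m \<and> j \<in> dom (deco ?m))"
  proof safe
    fix i j k y assume *: "i < j" "j < k" "{i, k} \<in> pairs ?m" "deco ?m j = Some y"
    then obtain l where "r j l" "i < l" "l < k"
      using nested unfolding pairs_r by blast
    moreover then have "l \<in> A" using * mem[of i k l] unfolding pairs_r by auto
    ultimately show False using *(4) by (auto simp: deco_matching_of_relation split: if_splits)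
  qed
  moreover have "\<not> (\<exists>i j. i < j \<and> deco ?m i = Some L \<and> deco ?m j = Some R)"
  proof safe
    fix i j assume *: "i < j" "deco ?m i = Some L" "deco ?m j = Some R"
    then have ij: "i \<in> A" "j \<in> A" "w i = L" "w j = R" "\<not> (\<exists>k\<in>A. r i k)" "\<not> (\<exists>k\<in>A. r j k)"
      by (auto simp: deco_matching_of_relation split: if_splits)
    then show False using L_before_R[of i j] *(1) by blast
  qed
  moreover have "word_of ?m i = w i" if "i \<in> A" for i
  proof (cases "\<exists>k\<in>A. r i k")
    case True
    then obtain k where k: "k \<in> A" "r i k" by blast
    then have eq: "r i k' \<longleftrightarrow> k' = k" for k' using unique by blast
    show ?thesis unfolding word_of_def pairs_r deco_matching_of_relation
      using k(1) that less_iff[OF that k] by (cases "w i") (auto simp: eq)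
  next
    case False
    then show ?thesis unfolding word_of_def pairs_r deco_matching_of_relation
      using that by (cases "w i") auto
  qed
  ultimately show ?thesis
    unfolding encoded_by_def noncrossing_def
    using partial_matching_on_matching_of_relation[of r A w] sym irrefl unique by blast
qed

definition canonical_matching :: "int set \<Rightarrow> (int \<Rightarrow> letter) \<Rightarrow> partial_matching" where
  "canonical_matching A w = matching_of_relation A (mate w) w"

lemma pairs_canonical: "{i, k} \<in> pairs (canonical_matching A w) \<longleftrightarrow> i \<in> A \<and> k \<in> A \<and> mate w i k"
  unfolding canonical_matching_def by (rule pairs_matching_of_relation) (simp add: mate_sym)

lemma deco_canonical:
  "deco (canonical_matching A w) i = (if i \<in> A \<and> \<not> (\<exists>k\<in>A. mate w i k) then Some (w i) else None)"
  by (simp add: canonical_matching_def deco_matching_of_relation)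

lemma encoded_by_canonical:
  assumes A: "interval A"
  shows "encoded_by A (canonical_matching A w) w"
  unfolding canonical_matching_def
proof (rule encoded_by_matching_of_relation[OF A])
  show "\<And>i k. mate w i k \<Longrightarrow> mate w k i" by (simp add: mate_sym)
  show "\<And>i j k. mate w i k \<Longrightarrow> i < j \<Longrightarrow> j < k \<Longrightarrow> \<exists>l. mate w j l \<and> i < l \<and> l < k"
    by (rule mate_between)
  show "\<And>i k k'. mate w i k \<Longrightarrow> mate w i k' \<Longrightarrow> k = k'" by (rule mate_unique)
  fix i j assume ij: "i \<in> A" "j \<in> A" "i < j" "w i = L" "w j = R"
  have mem: "k \<in> A" if "i \<le> k" "k \<le> j" for k
    using A ij that unfolding interval_def by (meson atLeastAtMost_iff subsetD)
  from unmatched_L_before_R[OF ij(3-5)]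
  show "(\<exists>k\<in>A. mate w i k) \<or> (\<exists>k\<in>A. mate w j k)"
  proof
    assume "\<exists>k\<le>j. matched w i k"
    then show ?thesis using mem matched_less unfolding mate_def by (meson less_imp_le)
  next
    assume "\<exists>k\<ge>i. matched w k j"
    then show ?thesis using mem matched_less unfolding mate_def by (meson less_imp_le)
  qed
qed (simp_all add: mate_less)

lemma partial_matching_onD:
  assumes m: "partial_matching_on A m"
  shows "{i, k} \<in> pairs m \<Longrightarrow> i \<in> A \<and> k \<in> A \<and> i \<noteq> k \<and> deco m i = None \<and> deco m k = None"
    and "{i, k} \<in> pairs m \<Longrightarrow> {i, k'} \<in> pairs m \<Longrightarrow> k = k'"
    and "i \<in> A \<Longrightarrow> i \<in> dom (deco m) \<or> (\<exists>k. {i, k} \<in> pairs m)"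
    and "i \<in> dom (deco m) \<Longrightarrow> i \<in> A"
    and "p \<in> pairs m \<Longrightarrow> \<exists>i k. p = {i, k} \<and> i < k"
proof -
  let ?S = "(\<lambda>i. {i}) ` dom (deco m)"
  have un: "\<Union> (pairs m \<union> ?S) = A" and dj: "disjoint (pairs m \<union> ?S)"
    and c: "\<And>p. p \<in> pairs m \<Longrightarrow> card p = 2"
    using m unfolding partial_matching_on_def partition_on_def by auto
  have same: "p = q" if "p \<in> pairs m \<union> ?S" "q \<in> pairs m \<union> ?S" "x \<in> p" "x \<in> q" for p q x
    using disjointD[OF dj that(1,2)] that(3,4) by blast
  have ne: "i \<noteq> k" if "{i, k} \<in> pairs m" for i k using c[OF that] by auto
  have nd: "deco m x = None" if "{i, k} \<in> pairs m" "x \<in> {i, k}" for i k x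
  proof (rule ccontr)
    assume "deco m x \<noteq> None"
    then have "{x} \<in> ?S" by auto
    then have "{x} = {i, k}" using same[of "{x}" "{i, k}" x] that by auto
    then show False using ne[OF that(1)] by auto
  qed
  show "{i, k} \<in> pairs m \<Longrightarrow> i \<in> A \<and> k \<in> A \<and> i \<noteq> k \<and> deco m i = None \<and> deco m k = None"
    using un ne nd by blast
  show "{i, k} \<in> pairs m \<Longrightarrow> {i, k'} \<in> pairs m \<Longrightarrow> k = k'"
    using same[of "{i, k}" "{i, k'}" i] ne by (auto simp: doubleton_eq_iff)
  show "i \<in> dom (deco m) \<Longrightarrow> i \<in> A" using un by auto
  show two: "p \<in> pairs m \<Longrightarrow> \<exists>i k. p = {i, k} \<and> i < k" for p
  proof -
    assume "p \<in> pairs m"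
    then obtain i k where ik: "p = {i, k}" "i \<noteq> k" using c card_2_iff by metis
    then show ?thesis by (metis insert_commute linorder_neqE)
  qed
  show "i \<in> dom (deco m) \<or> (\<exists>k. {i, k} \<in> pairs m)" if "i \<in> A"
  proof -
    have "i \<in> \<Union> (pairs m \<union> ?S)" using that un by simp
    then obtain p where p: "p \<in> pairs m \<union> ?S" "i \<in> p" by (rule UnionE)
    show ?thesis
    proof (cases "p \<in> pairs m")
      case True
      then obtain a b where "p = {a, b}" using two by blast
      then show ?thesis using True p(2) by (metis insert_commute insert_iff singletonD)
    next
      case False
      then show ?thesis using p by auto
    qed
  qed
qed

text \<open>Induction on the length of the arc. Points under an arc of \<open>m\<close> are paired
  by \<open>m\<close> under the same arc, so by induction these inner pairs are excursions; a
  premature return of the walk would give an inner point a second mate.\<close>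

lemma encoded_pair_matched:
  assumes e: "encoded_by A m w" and A: "interval A"
  shows "{i, k} \<in> pairs m \<Longrightarrow> i < k \<Longrightarrow> matched w i k"
proof (induction "nat (k - i)" arbitrary: i k rule: less_induct)
  case less
  have m: "partial_matching_on A m" and nc: "noncrossing m" and wd: "\<And>i. i \<in> A \<Longrightarrow> word_of m i = w i"
    using e by (auto simp: encoded_by_def)
  note D = partial_matching_onD[OF m]
  have letters: "w a = L" "w b = R" if "{a, b} \<in> pairs m" "a < b" for a b
  proof -
    have "word_of m a = L" using that unfolding word_of_def by auto
    then show "w a = L" using wd[of a] D(1)[OF that(1)] by simp
    have "\<not> (\<exists>k>b. {b, k} \<in> pairs m)"
    proof safe
      fix k assume "b < k" "{b, k} \<in> pairs m"
      then have "a = k" using D(2)[of b a k] that(1) by (simp add: insert_commute)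
      then show False using that(2) \<open>b < k\<close> by simp
    qed
    then have "word_of m b = R" using D(1)[OF that(1)] by (simp add: word_of_def)
    then show "w b = R" using wd[of b] D(1)[OF that(1)] by simp
  qed
  have inner: "\<exists>s. {j, s} \<in> pairs m \<and> i < s \<and> s < k" if j: "i < j" "j < k" for j
  proof -
    have "i \<in> A" "k \<in> A" using D(1)[OF less.prems(1)] by auto
    then have "j \<in> A" using A j unfolding interval_def by (meson atLeastAtMost_iff less_imp_le subsetD)
    moreover have "j \<notin> dom (deco m)" using nc less.prems j unfolding noncrossing_def by blast
    ultimately obtain s where s: "{j, s} \<in> pairs m" using D(3) by blast
    have "s \<noteq> i" "s \<noteq> k"
      using D(2)[of i k j] D(2)[of k i j] s less.prems j by (auto simp: insert_commute)
    moreover have "\<not> k < s" using nc s less.prems j unfolding noncrossing_def by blast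
    moreover have "\<not> s < i"
      using nc s less.prems j unfolding noncrossing_def by (metis insert_commute)
    ultimately show ?thesis using s by (meson linorder_neqE)
  qed
  have IH: "matched w a b" if "{a, b} \<in> pairs m" "a < b" "i \<le> a" "b \<le> k" "b - a < k - i" for a b
    using less.hyps[of b a] that by auto
  have pos: "height w i t > 0" if t: "i \<le> t" "t < k" for t
  proof (rule ccontr)
    assume "\<not> height w i t > 0"
    then obtain t' where t': "t' \<le> t" "matched w i t'"
      using ex_matched_right[of w i t] letters[OF less.prems] t by auto
    have "i < t'" using t'(2) by (rule matched_less)
    then obtain s where s: "{t', s} \<in> pairs m" "i < s" "s < k" using inner[of t'] t' t by auto
    have "s < t'"
      using letters(1)[of t' s] s(1) matched_right_letter[OF t'(2)] D(1)[OF s(1)] by force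
    then have "matched w s t'"
      using IH[of s t'] s t' t by (auto simp: insert_commute)
    then show False using matched_left_unique[OF t'(2)] s(2) by blast
  qed
  \<comment> \<open>Mirror image of the previous argument: a positive inner height would match
    \<open>k\<close> with an inner point, whose partner in \<open>m\<close> is another inner point.
    With \<open>pos\<close> at \<open>k - 1\<close> the inner height is then 0.\<close>
  have "height w (i + 1) (k - 1) \<le> 0"
  proof (rule ccontr)
    assume "\<not> height w (i + 1) (k - 1) \<le> 0"
    then have "height w (i + 1) k \<ge> 0" using height_last[of "i + 1" k w] letters(2)[OF less.prems]
      height_empty[of "k - 1" "i + 1" w] by (cases "i + 1 \<le> k") auto
    then obtain t where t: "i + 1 \<le> t" "matched w t k"
      using ex_matched_left[of w k "i + 1"] letters(2)[OF less.prems] less.prems by auto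
    have "t < k" using t(2) by (rule matched_less)
    then obtain s where s: "{t, s} \<in> pairs m" "i < s" "s < k" using inner[of t] t by auto
    have "t < s"
      using letters(2)[of s t] s(1) matched_left_letter[OF t(2)] D(1)[OF s(1)]
      by (force simp: insert_commute)
    then have "matched w t s" using IH[of t s] s t by auto
    then show False using matched_right_unique[OF t(2)] s(3) by blast
  qed
  moreover have "height w i k = step (w i) + height w (i + 1) (k - 1) + step (w k)"
    using height_first[of i k w] height_last[of "i + 1" k w] less.prems by simp
  moreover have "height w i (k - 1) > 0" using pos[of "k - 1"] less.prems by simp
  moreover have "height w i (k - 1) = step (w i) + height w (i + 1) (k - 1)"
    using height_first[of i "k - 1" w] less.prems by simp
  ultimately have "height w i k = 0" using letters[OF less.prems] by simp
  then show ?case unfolding matched_def using pos less.prems by blast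
qed

text \<open>Pairs of \<open>m\<close> are excursions. Conversely two mates cannot both be singletons
  of \<open>m\<close>, since they would be decorated \<open>L\<close> before \<open>R\<close>; once
  one of them is paired, uniqueness of mates determines its partner.\<close>

lemma encoded_by_unique:
  assumes e: "encoded_by A m w" and A: "interval A"
  shows "m = canonical_matching A w"
proof -
  have m: "partial_matching_on A m" and nc: "noncrossing m" and wd: "\<And>i. i \<in> A \<Longrightarrow> word_of m i = w i"
    using e by (auto simp: encoded_by_def)
  note D = partial_matching_onD[OF m]
  have sgl: "deco m i = Some (w i)" if i: "i \<in> dom (deco m)" for i
  proof -
    have "\<not> (\<exists>k. {i, k} \<in> pairs m)" using D(1)[of i] i by (metis domIff)
    then have "w i = (if deco m i = Some L then L else R)"
      using wd[OF D(4)[OF i]] unfolding word_of_def by auto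
    then show ?thesis using i by (auto split: if_splits)
  qed
  have pair: "mate w i k" if "{i, k} \<in> pairs m" for i k
    using encoded_pair_matched[OF e A, of i k] encoded_pair_matched[OF e A, of k i] D(1)[OF that] that
    unfolding mate_def by (metis insert_commute linorder_neqE)
  have conv: "{i, k} \<in> pairs m" if "i \<in> A" "k \<in> A" "matched w i k" for i k
  proof (cases "(\<exists>j. {i, j} \<in> pairs m) \<or> (\<exists>j. {k, j} \<in> pairs m)")
    case True
    then show ?thesis
    proof
      assume "\<exists>j. {i, j} \<in> pairs m"
      then obtain j where j: "{i, j} \<in> pairs m" by blast
      then have "j = k" using mate_unique[of w i j k] pair[OF j] that(3) by (simp add: mate_def)
      then show ?thesis using j by simp
    next
      assume "\<exists>j. {k, j} \<in> pairs m"
      then obtain j where j: "{k, j} \<in> pairs m" by blast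
      then have "j = i" using mate_unique[of w k j i] pair[OF j] that(3) by (simp add: mate_def)
      then show ?thesis using j by (simp add: insert_commute)
    qed
  next
    case False
    then have "deco m i = Some L" "deco m k = Some R"
      using sgl[of i] sgl[of k] D(3)[OF that(1)] D(3)[OF that(2)]
        matched_left_letter[OF that(3)] matched_right_letter[OF that(3)] by auto
    then show ?thesis using nc matched_less[OF that(3)] unfolding noncrossing_def by blast
  qed
  have P: "pairs m = pairs (canonical_matching A w)"
  proof (intro equalityI subsetI)
    fix p assume "p \<in> pairs m"
    moreover then obtain i k where "p = {i, k}" using D(5) by blast
    ultimately show "p \<in> pairs (canonical_matching A w)"
      using pair D(1) by (auto simp: pairs_canonical)
  next
    fix p assume "p \<in> pairs (canonical_matching A w)"
    then obtain i k where "p = {i, k}" "i \<in> A" "k \<in> A" "mate w i k"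
      by (auto simp: canonical_matching_def matching_of_relation_def)
    then show "p \<in> pairs m" using conv[of i k] conv[of k i] by (auto simp: mate_def insert_commute)
  qed
  have "deco m i = deco (canonical_matching A w) i" for i
  proof (cases "i \<in> dom (deco m)")
    case True
    have "\<not> (\<exists>k\<in>A. mate w i k)"
    proof
      assume "\<exists>k\<in>A. mate w i k"
      then obtain k where "{i, k} \<in> pairs m" using D(4)[OF True] P pairs_canonical by blast
      then show False using D(1)[of i k] True by auto
    qed
    then show ?thesis using True sgl D(4) by (simp add: deco_canonical)
  next
    case False
    then have "i \<in> A \<longrightarrow> (\<exists>k\<in>A. mate w i k)"
      using D(1) D(3) pair by blast
    then show ?thesis using False by (auto simp: deco_canonical)
  qed
  then have "deco m = deco (canonical_matching A w)" by blast
  then show ?thesis using P by simp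
qed

lemma matching_of_word_eq: "interval A \<Longrightarrow> matching_of_word A w = canonical_matching A w"
  unfolding matching_of_word_def
  using encoded_by_canonical encoded_by_unique by (intro the_equality) blast+

lemma canonical_matching_cong:
  assumes "interval A" "\<And>i. i \<in> A \<Longrightarrow> w i = w' i"
  shows "canonical_matching A w = canonical_matching A w'"
  using encoded_by_canonical[OF assms(1), of w] assms
  by (intro encoded_by_unique) (auto simp: encoded_by_def)

section \<open>Perfect matchings and restrictions of the noodle\<close>

definition matchable :: "(int \<Rightarrow> letter) \<Rightarrow> bool" where
  "matchable w \<longleftrightarrow> (\<forall>i. \<exists>k. mate w i k)"

lemma perfect_matching_of_iff: "perfect_matching_of w m \<longleftrightarrow> matchable w \<and> m = canonical_matching UNIV w"
proof -
  have "deco (canonical_matching UNIV w) = Map.empty \<longleftrightarrow> matchable w"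
    unfolding matchable_def fun_eq_iff by (auto simp: deco_canonical)
  then show ?thesis unfolding perfect_matching_of_def
    using encoded_by_canonical[of UNIV w] encoded_by_unique[of UNIV m w] by auto
qed

lemma noodle_matching_eq:
  "noodle_matching w = (if matchable w then canonical_matching UNIV w else \<lparr>pairs = {}, deco = Map.empty\<rparr>)"
proof (cases "matchable w")
  case True
  then have "(THE m. perfect_matching_of w m) = canonical_matching UNIV w"
    by (intro the_equality) (simp_all add: perfect_matching_of_iff)
  then show ?thesis using True unfolding noodle_matching_def perfect_matching_of_iff by auto
next
  case False
  then show ?thesis unfolding noodle_matching_def perfect_matching_of_iff by auto
qed

lemma pairs_noodle: "{i, k} \<in> pairs (noodle_matching w) \<longleftrightarrow> matchable w \<and> mate w i k"
  by (simp add: noodle_matching_eq pairs_canonical)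

lemma pairs_restrict: "{i, k} \<in> pairs (restrict_matching m B) \<longleftrightarrow> i \<in> B \<and> k \<in> B \<and> {i, k} \<in> pairs m"
  by (auto simp: restrict_matching_def)

text \<open>A cut arc leaves \<open>L\<close> at its left end and \<open>R\<close> at its right end,
  which are the letters the word already has there; so restricting commutes with encoding.\<close>

lemma restrict_canonical:
  assumes "B \<subseteq> A"
  shows "restrict_matching (canonical_matching A w) B = canonical_matching B w"
proof -
  have P: "pairs (restrict_matching (canonical_matching A w) B) = pairs (canonical_matching B w)"
    using assms by (auto simp: restrict_matching_def canonical_matching_def matching_of_relation_def)
  have "deco (restrict_matching (canonical_matching A w) B) i = deco (canonical_matching B w) i" for i
  proof (cases "i \<in> B \<and> (\<exists>k\<in>A. mate w i k)")
    case True
    then obtain k where k: "k \<in> A" "mate w i k" by blast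
    then have eq: "mate w i k' \<longleftrightarrow> k' = k" for k' using mate_unique by blast
    have "i \<noteq> k" using k by auto
    then consider "i < k" | "k < i" by linarith
    then show ?thesis
      using True k(1) assms mate_less[OF k(2)]
      by cases (auto simp: restrict_matching_def deco_canonical pairs_canonical eq dom_def)
  next
    case False
    then show ?thesis using assms
      by (auto simp: restrict_matching_def deco_canonical pairs_canonical dom_def)
  qed
  then have "deco (restrict_matching (canonical_matching A w) B) = deco (canonical_matching B w)"
    by blast
  with P show ?thesis by simp
qed

section \<open>The first escape to the left\<close>

lemma even_card_involution:
  assumes "finite X" "\<And>x. x \<in> X \<Longrightarrow> g x \<in> X \<and> g x \<noteq> x \<and> g (g x) = x"
  shows "even (card X)"
  using assms
proof (induction "card X" arbitrary: X rule: less_induct)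
  case less
  show ?case
  proof (cases "X = {}")
    case False
    then obtain x where x: "x \<in> X" by blast
    let ?Y = "X - {x, g x}"
    have gx: "g x \<in> X" "g x \<noteq> x" "g (g x) = x" using less.prems(2)[OF x] by auto
    have "card {x, g x} = 2" using gx by auto
    then have card: "card X = card ?Y + 2"
      using less.prems(1) x gx card_Diff_subset[of "{x, g x}" X] card_mono[of X "{x, g x}"] by auto
    have "g z \<in> ?Y \<and> g z \<noteq> z \<and> g (g z) = z" if "z \<in> ?Y" for z
      using less.prems(2)[of z] less.prems(2)[OF x] that by auto
    then have "even (card ?Y)" using less.hyps[of ?Y] card less.prems(1) by auto
    then show ?thesis using card by simp
  qed simp
qed

text \<open>The two sides of the line are indexed by booleans, and \<open>f a x\<close> is the partner of \<open>x\<close>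
  on side \<open>a\<close>.\<close>

locale noncrossing_pairings =
  fixes f :: "bool \<Rightarrow> int \<Rightarrow> int"
  assumes invol [simp]: "f a (f a x) = x"
    and no_fixpoint [simp]: "f a x \<noteq> x"
    and nested: "x < y \<Longrightarrow> y < f a x \<Longrightarrow> x < f a y \<and> f a y < f a x"
begin

definition cluster :: "int set \<Rightarrow> int \<Rightarrow> int set" where
  "cluster B x = {y. (x, y) \<in> {(p, q). p \<in> B \<and> q \<in> B \<and> (\<exists>a. q = f a p)}\<^sup>*}"

text \<open>Exits are half-arcs rather than points: a point whose two arcs both leave
  \<open>C\<close> counts twice.\<close>

definition exits :: "int set \<Rightarrow> (int \<times> bool) set" where
  "exits C = {(y, a). y \<in> C \<and> f a y \<notin> C}"

lemma cluster_self [simp]: "x \<in> cluster B x"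
  by (simp add: cluster_def)

lemma cluster_subset_closed:
  assumes "x \<in> X" "\<And>y a. y \<in> X \<Longrightarrow> y \<in> B \<Longrightarrow> f a y \<in> B \<Longrightarrow> f a y \<in> X"
  shows "cluster B x \<subseteq> X"
proof
  fix y assume "y \<in> cluster B x"
  then have "(x, y) \<in> {(p, q). p \<in> B \<and> q \<in> B \<and> (\<exists>a. q = f a p)}\<^sup>*" by (simp add: cluster_def)
  then show "y \<in> X" by induction (use assms in auto)
qed

lemma cluster_subset: "x \<in> B \<Longrightarrow> cluster B x \<subseteq> B"
  by (rule cluster_subset_closed)

lemma cluster_step:
  assumes "x \<in> B" "y \<in> cluster B x" "f a y \<in> B"
  shows "f a y \<in> cluster B x"
proof -
  have "y \<in> B" using assms cluster_subset by blast
  then have "(y, f a y) \<in> {(p, q). p \<in> B \<and> q \<in> B \<and> (\<exists>a. q = f a p)}" using assms by auto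
  then show ?thesis using assms(2) unfolding cluster_def by (auto intro: rtrancl_into_rtrancl)
qed

lemma cluster_mono:
  assumes "x \<in> B" "B \<subseteq> B'"
  shows "cluster B x \<subseteq> cluster B' x"
  using cluster_subset_closed[of x "cluster B' x" B] cluster_step[of x B'] assms by auto

lemma finite_exits: "finite C \<Longrightarrow> finite (exits C)"
  by (rule finite_subset[of _ "C \<times> UNIV"]) (auto simp: exits_def)

lemma even_card_closed: "finite X \<Longrightarrow> (\<And>x. x \<in> X \<Longrightarrow> f a x \<in> X) \<Longrightarrow> even (card X)"
  by (rule even_card_involution[of X "f a"]) auto

text \<open>Count half-arcs: \<open>C\<close> has \<open>2 * card C\<close> of them, and those that
  stay in \<open>C\<close> are matched up by following the arc.\<close>

lemma even_card_exits:
  assumes "finite C"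
  shows "even (card (exits C))"
proof -
  let ?I = "{(y, a). y \<in> C \<and> f a y \<in> C}"
  have fin: "finite ?I" by (rule finite_subset[of _ "C \<times> UNIV"]) (use assms in auto)
  have "even (card ?I)"
    by (rule even_card_involution[OF fin, of "\<lambda>(y, a). (f a y, a)"]) auto
  moreover have "card (C \<times> (UNIV :: bool set)) = card ?I + card (exits C)"
  proof -
    have "C \<times> (UNIV :: bool set) = ?I \<union> exits C" "?I \<inter> exits C = {}" by (auto simp: exits_def)
    then show ?thesis using card_Un_disjoint[OF fin finite_exits[OF assms]] by simp
  qed
  moreover have "even (card (C \<times> (UNIV :: bool set)))"
    by (simp only: card_cartesian_product card_UNIV_bool) simp
  ultimately show ?thesis using even_add[of "card ?I" "card (exits C)"] by argo
qed

text \<open>Growing a set from \<open>x\<close> one neighbour at a time replaces at least one exit by at most one,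
  so the number of exits never exceeds that of a single point.\<close>

lemma card_exits_cluster:
  assumes "finite B" "x \<in> B"
  shows "card (exits (cluster B x)) \<le> 2"
proof -
  let ?C = "cluster B x"
  define G where "G = {Y. x \<in> Y \<and> Y \<subseteq> ?C \<and> card (exits Y) \<le> 2}"
  have finC: "finite ?C" using assms cluster_subset finite_subset by metis
  have "exits {x} \<subseteq> {x} \<times> UNIV" by (auto simp: exits_def)
  then have "card (exits {x}) \<le> card ({x} \<times> (UNIV :: bool set))" by (intro card_mono) auto
  then have xG: "{x} \<in> G" by (auto simp: G_def)
  have "finite G" by (rule finite_subset[of _ "Pow ?C"]) (use finC in \<open>auto simp: G_def\<close>)
  then have "Max (card ` G) \<in> card ` G" using xG by (intro Max_in) auto
  then obtain Y where "Y \<in> G" "card Y = Max (card ` G)" by auto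
  then have Y: "Y \<in> G" "\<And>Z. Z \<in> G \<Longrightarrow> card Z \<le> card Y" using \<open>finite G\<close> by simp_all
  then have Y': "x \<in> Y" "Y \<subseteq> ?C" "card (exits Y) \<le> 2" by (auto simp: G_def)
  have finY: "finite Y" using Y' finC finite_subset by blast
  have "Y = ?C"
  proof (rule ccontr)
    assume "Y \<noteq> ?C"
    then have "\<not> ?C \<subseteq> Y" using Y' by blast
    then obtain y a where ya: "y \<in> Y" "f a y \<in> B" "f a y \<notin> Y"
      using cluster_subset_closed[of x Y B] Y'(1) by blast
    let ?z = "f a y"
    have z: "?z \<in> ?C" using cluster_step[of x B y a] assms ya Y' by blast
    \<comment> \<open>The arc from \<open>y\<close> to \<open>?z\<close> is now internal, so only
      the other side of \<open>?z\<close> can add an exit.\<close>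
    have "exits (insert ?z Y) \<subseteq> insert (?z, \<not> a) (exits Y - {(y, a)})"
    proof
      fix q assume q: "q \<in> exits (insert ?z Y)"
      obtain p e where pe: "q = (p, e)" by force
      show "q \<in> insert (?z, \<not> a) (exits Y - {(y, a)})"
        using q ya unfolding pe by (cases "p = ?z"; cases "e = a") (auto simp: exits_def)
    qed
    moreover have "(y, a) \<in> exits Y" using ya by (simp add: exits_def)
    moreover have fe: "finite (exits Y)" using finY by (rule finite_exits)
    ultimately have "card (exits (insert ?z Y)) \<le> card (insert (?z, \<not> a) (exits Y - {(y, a)}))"
      by (intro card_mono) auto
    also have "\<dots> \<le> Suc (card (exits Y - {(y, a)}))" by (rule card_insert_le_m1) auto
    also have "\<dots> = card (exits Y)"
      using \<open>(y, a) \<in> exits Y\<close> fe card_Suc_Diff1 by metis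
    finally have "insert ?z Y \<in> G" using Y' z by (auto simp: G_def)
    then show False using Y(2)[of "insert ?z Y"] ya finY by simp
  qed
  then show ?thesis using Y' by simp
qed

text \<open>With \<open>D\<close> the part of the component of \<open>0\<close> seen before \<open>K\<close> and \<open>A\<close> the part discovered
  through \<open>K\<close>, every arc between points of \<open>D\<close> covers an even number of points of \<open>A\<close>, so an even
  number of points of \<open>A\<close> lie to the left of each point of \<open>D\<close>. This parity forces both exits of
  \<open>D\<close> to be on the same side, and \<open>A\<close> to be odd.\<close>

lemma exits_first_escape:
  fixes K :: int
  defines "D \<equiv> cluster {0..K - 1} 0" and "S \<equiv> cluster {0..K} 0"
  assumes K: "1 \<le> K"
    and before: "cluster {..K - 1} 0 \<subseteq> {0..}"
    and escape: "\<exists>j\<in>cluster {..K} 0. j < 0"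
  shows "odd (card S) \<and> K \<in> S \<and> (\<forall>p\<in>D. \<forall>e. f e p \<in> D \<or> K \<le> f e p) \<and>
    (\<exists>x y a. exits S = {(y, a), (x, \<not> a)} \<and> K < f a y \<and> f (\<not> a) x < 0)"
proof -
  have D_sub: "D \<subseteq> {0..K - 1}" and S_sub: "S \<subseteq> {0..K}"
    unfolding D_def S_def using K by (intro cluster_subset; simp)+
  have finD: "finite D" and finS: "finite S" using D_sub S_sub finite_subset by auto
  have D0: "0 \<in> D" and S0: "0 \<in> S" by (simp_all add: D_def S_def)
  have DS: "D \<subseteq> S" unfolding D_def S_def using K by (intro cluster_mono) auto
  have D_step: "f a y \<in> D" if "y \<in> D" "0 \<le> f a y" "f a y < K" for a y
    using cluster_step[of 0 "{0..K - 1}" y a] that K unfolding D_def by auto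
  have S_step: "f a y \<in> S" if "y \<in> S" "0 \<le> f a y" "f a y \<le> K" for a y
    using cluster_step[of 0 "{0..K}" y a] that K unfolding S_def by auto
  \<comment> \<open>By \<open>before\<close>, nothing left of \<open>0\<close> is reachable while
    staying below \<open>K\<close>, so a path leaves \<open>D\<close> only towards \<open>K\<close>
    or beyond.\<close>
  have D_exit: "f a y \<in> D \<or> K \<le> f a y" if "y \<in> D" for a y
  proof (rule ccontr)
    assume *: "\<not> (f a y \<in> D \<or> K \<le> f a y)"
    have "D \<subseteq> cluster {..K - 1} 0" unfolding D_def using K by (intro cluster_mono) auto
    then have "f a y \<in> cluster {..K - 1} 0"
      using cluster_step[of 0 "{..K - 1}" y a] that K * by auto
    then show False using before D_step[OF that] * by auto
  qed
  \<comment> \<open>A set containing \<open>0\<close> and closed under all arcs ending at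
    \<open>K\<close> or earlier contains the whole escaping component, hence a negative
    point.\<close>
  have no_escape: "\<not> X \<subseteq> {0..}" if "0 \<in> X" "\<And>y a. y \<in> X \<Longrightarrow> f a y \<le> K \<Longrightarrow> f a y \<in> X" for X
    using cluster_subset_closed[of 0 X "{..K}"] that escape by force
  obtain x c where x: "x \<in> S" "f c x < 0"
  proof -
    have "\<exists>y a. y \<in> S \<and> f a y \<le> K \<and> f a y \<notin> S" using no_escape[of S] S0 S_sub by force
    then show ?thesis using S_step that by (metis not_le)
  qed
  have xD: "x \<notin> D" using D_exit[of x c] x D_sub K by force
  obtain d a where d: "d \<in> D" "f a d = K"
  proof -
    have "\<not> S \<subseteq> D" using x xD by blast
    then obtain y a where "y \<in> D" "f a y \<in> {0..K}" "f a y \<notin> D"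
      using cluster_subset_closed[of 0 D "{0..K}"] D0 unfolding S_def by blast
    then show ?thesis using D_exit[of y a] that[of y a] by auto
  qed
  have KD: "K \<notin> D" using D_sub by auto
  have KS: "K \<in> S" using S_step[of d a] d DS K by auto
  have fK: "f a K = d" using d invol by metis
  have exD: "(y, e) \<in> exits D \<longleftrightarrow> y \<in> D \<and> K \<le> f e y" for y e
    using D_exit[of y e] D_sub by (auto simp: exits_def)
  have cD: "card (exits D) \<le> 2" "even (card (exits D))"
    unfolding D_def using K finD card_exits_cluster even_card_exits by (auto simp: D_def)
  have dD: "(d, a) \<in> exits D" using d by (simp add: exD)
  have "card (exits D) \<noteq> 0" using dD finite_exits[OF finD] by auto
  then have "card (exits D) = 2" using cD by (cases "card (exits D) = 1") auto
  then obtain y b where yb: "exits D = {(d, a), (y, b)}" "(y, b) \<noteq> (d, a)"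
    using dD unfolding card_2_iff by (metis doubleton_eq_iff insertE prod.exhaust singletonD)
  have y: "y \<in> D" "K \<le> f b y" using yb(1) exD[of y b] by auto
  \<comment> \<open>If both exits of \<open>D\<close> led to \<open>K\<close>, then
    \<open>insert K D\<close> would be closed under arcs ending at \<open>K\<close> or earlier, and
    there would be no escape to the left.\<close>
  have fy: "K < f b y"
  proof (rule ccontr)
    assume "\<not> K < f b y"
    then have fyK: "f b y = K" using y by simp
    then have "b \<noteq> a" using fK yb(2) invol[of b y] fyK by (intro notI) simp
    have fbK: "f b K = y" using fyK invol by metis
    have "f e z \<in> insert K D" if "z \<in> insert K D" "f e z \<le> K" for e z
    proof (cases "z = K")
      case True
      then show ?thesis using fK fbK \<open>b \<noteq> a\<close> d y by (cases "e = a") auto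
    next
      case False
      then show ?thesis using D_exit[of z e] that by auto
    qed
    then have "\<not> insert K D \<subseteq> {0..}" using no_escape[of "insert K D"] D0 by blast
    then show False using D_sub K by auto
  qed
  \<comment> \<open>The exit of \<open>D\<close> beyond \<open>K\<close> is still an exit of
    \<open>S\<close>; with the escape at \<open>x\<close> this exhausts the two exits
    allowed.\<close>
  have exS: "exits S = {(y, b), (x, c)}" and xy: "(y, b) \<noteq> (x, c)"
  proof -
    have ne: "(y, b) \<noteq> (x, c)" using fy x K by (intro notI) simp
    have sub: "{(y, b), (x, c)} \<subseteq> exits S" using y fy x S_sub DS by (auto simp: exits_def)
    have "card (exits S) \<le> 2" unfolding S_def using K by (intro card_exits_cluster) auto
    then have "{(y, b), (x, c)} = exits S"
      using ne sub finite_exits[OF finS] by (intro card_seteq) auto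
    then show "exits S = {(y, b), (x, c)}" "(y, b) \<noteq> (x, c)" using ne by auto
  qed
  define A where "A = S - D"
  have finA: "finite A" using finS by (simp add: A_def)
  have A_sub: "A \<subseteq> {0..K}" using S_sub by (auto simp: A_def)
  have KA: "K \<in> A" using KS KD by (simp add: A_def)
  define N where "N p = card {z \<in> A. z < p}" for p
  \<comment> \<open>By nesting, \<open>f e\<close> maps the points of \<open>A\<close> under the arc
    among themselves: they stay within \<open>{0..K}\<close>, hence in \<open>S\<close>, and cannot
    enter \<open>D\<close>, since \<open>D\<close> would then contain \<open>z\<close> as
    well.\<close>
  have A_arc: "even (card {z \<in> A. p < z \<and> z < f e p})"
    if "p \<in> D" "p < f e p" "f e p \<le> K" for p e
  proof (rule even_card_closed[of _ e])
    fix z assume "z \<in> {z \<in> A. p < z \<and> z < f e p}"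
    then have z: "z \<in> S" "z \<notin> D" "p < z" "z < f e p" by (auto simp: A_def)
    have fz: "p < f e z" "f e z < f e p" using nested[OF z(3,4)] by auto
    moreover have "0 \<le> p" using that D_sub by auto
    ultimately have "f e z \<in> S" using S_step[of z e] z that by auto
    moreover have "f e z \<notin> D" using D_step[of "f e z" e] z \<open>0 \<le> p\<close> that by auto
    ultimately show "f e z \<in> {z \<in> A. p < z \<and> z < f e p}" using fz by (auto simp: A_def)
  qed (use finA in auto)
  have N_split: "N q = N p + card {z \<in> A. p < z \<and> z < q}" if "p < q" "p \<notin> A" for p q
  proof -
    have "{z \<in> A. z < q} = {z \<in> A. z < p} \<union> {z \<in> A. p < z \<and> z < q}"
      using that by (auto simp: not_less_iff_gr_or_eq)
    then show ?thesis unfolding N_def using finA by (simp add: card_Un_disjoint disjoint_iff)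
  qed
  have N_arc: "even (N q) = even (N p)" if "p \<in> D" "q \<in> D" "p < q" "q = f e p" for p q e
    using N_split[of p q] A_arc[of p e] that D_sub by (auto simp: A_def)
  have N_even: "even (N p)" if "p \<in> D" for p
  proof -
    have "{z \<in> A. z < 0} = {}" using A_sub by auto
    then have "N 0 = 0" by (simp only: N_def card.empty)
    moreover have "even (N (f e p))" if "p \<in> D" "even (N p)" "f e p \<in> D" for p e
    proof (cases "p < f e p")
      case True
      then show ?thesis using N_arc[of p "f e p" e] that by simp
    next
      case False
      then have "f e p < p" using no_fixpoint[of e p] by linarith
      then show ?thesis using N_arc[of "f e p" p e] that by simp
    qed
    ultimately have "D \<subseteq> {p \<in> D. even (N p)}"
      unfolding D_def using D0 D_step by (intro cluster_subset_closed) (auto simp: D_def)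
    then show ?thesis using that by blast
  qed
  \<comment> \<open>\<open>K\<close> is the last point of \<open>A\<close>. The points of
    \<open>A\<close> before it split at \<open>d\<close>, the left end of the arc through which
    \<open>K\<close> is reached, into two sets of even size.\<close>
  have oddA: "odd (card A)"
  proof -
    have "A = insert K {z \<in> A. z < K}" using KA A_sub by auto
    then have "card A = Suc (N K)" unfolding N_def using finA
      by (metis (no_types, lifting) card_insert_disjoint finite_insert less_irrefl mem_Collect_eq)
    moreover have "even (N K)"
      using N_split[of d K] A_arc[of d a] N_even[of d] d D_sub by (auto simp: A_def)
    ultimately show ?thesis by simp
  qed
  \<comment> \<open>Otherwise \<open>y\<close> carries the only exit of \<open>D\<close> on side
    \<open>b\<close>, and the points of \<open>A\<close> to the right of \<open>y\<close>, all of
    them under its long arc, are paired by \<open>f b\<close>. As \<open>N y\<close> is even,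
    \<open>card A\<close> would be even.\<close>
  have ba: "b = a"
  proof (rule ccontr)
    assume "b \<noteq> a"
    have "even (card {z \<in> A. y < z \<and> z < K + 1})"
    proof (rule even_card_closed[of _ b])
      fix z assume "z \<in> {z \<in> A. y < z \<and> z < K + 1}"
      then have z: "z \<in> S" "z \<notin> D" "y < z" "z \<le> K" by (auto simp: A_def)
      have fz: "y < f b z" "f b z < f b y" using nested[of y z b] z fy by auto
      have "0 \<le> y" using y D_sub by auto
      have S: "f b z \<in> S"
      proof (rule ccontr)
        assume "f b z \<notin> S"
        then have "(z, b) \<in> exits S" using z by (simp add: exits_def)
        then show False using exS z y x fz \<open>0 \<le> y\<close> by auto
      qed
      have "f b z \<notin> D"
      proof
        assume "f b z \<in> D"
        then have "(f b z, b) \<in> exits D" using z by (simp add: exits_def)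
        then show False using yb \<open>b \<noteq> a\<close> fz by auto
      qed
      then show "f b z \<in> {z \<in> A. y < z \<and> z < K + 1}" using S S_sub fz by (auto simp: A_def)
    qed (use finA in auto)
    moreover have "{z \<in> A. z < K + 1} = A" using A_sub by auto
    then have "N (K + 1) = card A" by (simp add: N_def)
    ultimately have "even (card A)"
      using N_split[of y "K + 1"] N_even[of y] y D_sub by (auto simp: A_def)
    then show False using oddA by simp
  qed
  have "even (card D)"
  proof (rule even_card_closed[OF finD, of "\<not> a"], rule ccontr)
    fix z assume "z \<in> D" "f (\<not> a) z \<notin> D"
    then have "(z, \<not> a) \<in> exits D" by (simp add: exits_def)
    then show False using yb ba by auto
  qed
  moreover have "card S = card A + card D"
    using card_Diff_subset[OF finD DS] card_mono[OF finS DS] by (simp add: A_def)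
  ultimately have oddS: "odd (card S)" using oddA by simp
  \<comment> \<open>Without an exit of \<open>S\<close> on side \<open>\<not> a\<close>, that side
    would pair up the points of \<open>S\<close>, against oddness.\<close>
  have "c = (\<not> a)"
  proof (rule ccontr)
    assume c: "c \<noteq> (\<not> a)"
    have "even (card S)"
    proof (rule even_card_closed[OF finS, of "\<not> a"], rule ccontr)
      fix z assume "z \<in> S" "f (\<not> a) z \<notin> S"
      then have "(z, \<not> a) \<in> exits S" by (simp add: exits_def)
      then show False using exS ba c by auto
    qed
    then show False using oddS by simp
  qed
  then have "exits S = {(y, a), (x, \<not> a)} \<and> K < f a y \<and> f (\<not> a) x < 0"
    using exS ba fy x by simp
  then show ?thesis using oddS KS D_exit by blast
qed

end

section \<open>Partial shapes\<close>

definition partner :: "(int \<Rightarrow> letter) \<Rightarrow> int \<Rightarrow> int" where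
  "partner w i = (THE k. mate w i k)"

lemma mate_iff_partner:
  assumes "matchable w"
  shows "mate w i k \<longleftrightarrow> k = partner w i"
proof -
  obtain j where j: "mate w i j" using assms by (auto simp: matchable_def)
  then have "partner w i = j" unfolding partner_def using mate_unique by blast
  then show ?thesis using j mate_unique by blast
qed

section \<open>Increasing labels of a finite set of points\<close>

abbreviation enum :: "int set \<Rightarrow> int \<Rightarrow> int" where
  "enum S i \<equiv> sorted_list_of_set S ! nat i"

lemma enum_mem:
  assumes "finite S" "i \<in> {0..<int (card S)}"
  shows "enum S i \<in> S"
proof -
  have "enum S i \<in> set (sorted_list_of_set S)" using assms by (intro nth_mem) auto
  then show ?thesis using assms by simp
qed

lemma enum_less_iff:
  assumes "finite S" "i \<in> {0..<int (card S)}" "j \<in> {0..<int (card S)}"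
  shows "enum S i < enum S j \<longleftrightarrow> i < j"
proof -
  have less: "enum S i < enum S j" if "i < j" "i \<in> {0..<int (card S)}" "j \<in> {0..<int (card S)}" for i j
  proof -
    have "sorted_wrt (<) (sorted_list_of_set S)" by simp
    moreover have "nat i < nat j" "nat j < length (sorted_list_of_set S)" using that by auto
    ultimately show ?thesis using sorted_wrt_nth_less by blast
  qed
  show ?thesis using less[of i j] less[of j i] assms by (cases i j rule: linorder_cases) auto
qed

lemma enum_eq_iff:
  assumes "finite S" "i \<in> {0..<int (card S)}" "j \<in> {0..<int (card S)}"
  shows "enum S i = enum S j \<longleftrightarrow> i = j"
  using enum_less_iff[OF assms] enum_less_iff[OF assms(1,3,2)]
  by (cases i j rule: linorder_cases) auto

lemma enum_surj:
  assumes "finite S" "p \<in> S"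
  obtains i where "i \<in> {0..<int (card S)}" "enum S i = p"
proof -
  have "p \<in> set (sorted_list_of_set S)" using assms by simp
  then obtain n where "n < length (sorted_list_of_set S)" "sorted_list_of_set S ! n = p"
    by (auto simp: in_set_conv_nth)
  then show ?thesis using that[of "int n"] by auto
qed

text \<open>The mates within \<open>S\<close>, moved to labels, encode the relabelled word, so
  uniqueness of the encoding identifies them with its mates. Closedness of \<open>S\<close> keeps
  the mate of a point of \<open>S\<close> under an arc of \<open>S\<close> inside
  \<open>S\<close>.\<close>

lemma mate_relabel:
  assumes w: "matchable w" and S: "S \<subseteq> {0..K}"
    and closed: "\<And>p q. p \<in> S \<Longrightarrow> q \<in> {0..K} \<Longrightarrow> mate w p q \<Longrightarrow> q \<in> S"
    and i: "i \<in> {0..<int (card S)}" and k: "k \<in> {0..<int (card S)}"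
  shows "mate (relabel S w) i k \<longleftrightarrow> mate w (enum S i) (enum S k)"
proof -
  have fin: "finite S" using S finite_subset by auto
  let ?A = "{0..<int (card S)}"
  define r where "r i k \<longleftrightarrow> i \<in> ?A \<and> k \<in> ?A \<and> mate w (enum S i) (enum S k)" for i k
  have "encoded_by ?A (matching_of_relation ?A r (relabel S w)) (relabel S w)"
  proof (rule encoded_by_matching_of_relation)
    show "\<And>i k. r i k \<Longrightarrow> r k i" by (auto simp: r_def mate_sym)
    show "\<And>i. \<not> r i i" by (simp add: r_def)
    show "k = k'" if "r i k" "r i k'" for i k k'
      using that mate_unique enum_eq_iff[OF fin] unfolding r_def by blast
    show "i < k \<longleftrightarrow> relabel S w i = L" if "r i k" for i k
      using that mate_less enum_less_iff[OF fin, of i k] by (auto simp: r_def relabel_def)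
    show "\<exists>l. r j l \<and> i < l \<and> l < k" if rik: "r i k" and "i < j" "j < k" for i j k
    proof -
      have A: "i \<in> ?A" "k \<in> ?A" "j \<in> ?A" using that by (auto simp: r_def)
      have "enum S i < enum S j" "enum S j < enum S k" using that A enum_less_iff[OF fin] by auto
      then obtain q where q: "mate w (enum S j) q" "enum S i < q" "q < enum S k"
        using mate_between rik unfolding r_def by blast
      have "enum S i \<in> {0..K}" "enum S k \<in> {0..K}" using enum_mem[OF fin] A S by blast+
      then have "q \<in> S" using closed[of "enum S j" q] enum_mem[OF fin A(3)] q by auto
      then obtain l where l: "l \<in> ?A" "enum S l = q" using enum_surj[OF fin] by blast
      then have "i < l" "l < k" using q enum_less_iff[OF fin] A by auto
      then show ?thesis using l q A unfolding r_def by blast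
    qed
    fix i j assume ij: "i \<in> ?A" "j \<in> ?A" "i < j" "relabel S w i = L" "relabel S w j = R"
    show "(\<exists>k\<in>?A. r i k) \<or> (\<exists>k\<in>?A. r j k)"
    proof (rule ccontr)
      assume none: "\<not> ?thesis"
      have out: "q \<notin> {0..K}" if "mate w (enum S l) q" "l = i \<or> l = j" for l q
      proof
        assume "q \<in> {0..K}"
        then have "q \<in> S" using closed[OF _ _ that(1)] that(2) ij enum_mem[OF fin] by blast
        then obtain k where "k \<in> ?A" "enum S k = q" using enum_surj[OF fin] by blast
        then show False using none that ij unfolding r_def by blast
      qed
      \<comment> \<open>An unpaired \<open>L\<close> has its mate beyond \<open>K\<close>, and an
        unpaired \<open>R\<close> to its right has its mate before \<open>0\<close>; these two arcs
        would cross.\<close>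
      obtain p q where pq: "mate w (enum S i) p" "mate w (enum S j) q"
        using w unfolding matchable_def by blast
      have "enum S i \<in> {0..K}" "enum S j \<in> {0..K}" using enum_mem[OF fin] ij S by blast+
      have "enum S i < p" using mate_less[OF pq(1)] ij by (simp add: relabel_def)
      moreover have "\<not> enum S j < q" using mate_less[OF pq(2)] ij by (simp add: relabel_def)
      ultimately have "K < p" "q < 0"
        using out[OF pq(1)] out[OF pq(2)] \<open>enum S i \<in> {0..K}\<close> \<open>enum S j \<in> {0..K}\<close> by auto
      moreover have "enum S i < enum S j" using enum_less_iff[OF fin ij(1,2)] ij(3) by blast
      moreover have "mate w q (enum S j)" using pq(2) by (simp add: mate_sym)
      ultimately obtain l where "mate w (enum S i) l" "l < enum S j"
        using mate_between[of w q "enum S j" "enum S i"] \<open>enum S i \<in> {0..K}\<close> by auto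
      then show False using mate_unique[OF pq(1)] \<open>K < p\<close> \<open>enum S j \<in> {0..K}\<close> by auto
    qed
  qed simp
  then have eq: "matching_of_relation ?A r (relabel S w) = canonical_matching ?A (relabel S w)"
    by (rule encoded_by_unique) simp
  have "{i, k} \<in> pairs (matching_of_relation ?A r (relabel S w)) \<longleftrightarrow> i \<in> ?A \<and> k \<in> ?A \<and> r i k"
    by (rule pairs_matching_of_relation) (auto simp: r_def mate_sym)
  then show ?thesis using i k unfolding eq pairs_canonical r_def by blast
qed

section \<open>The noodle of two matchable words\<close>

locale matchable_words =
  fixes u v :: "int \<Rightarrow> letter"
  assumes matchable_u: "matchable u" and matchable_v: "matchable v"
begin

definition word :: "bool \<Rightarrow> int \<Rightarrow> letter" where
  "word e = (if e then u else v)"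

lemma matchable_word: "matchable (word e)"
  by (simp add: word_def matchable_u matchable_v)

sublocale noncrossing_pairings "\<lambda>e. partner (word e)"
proof
  note m = mate_iff_partner[OF matchable_word]
  fix e x y
  show inv: "partner (word e) (partner (word e) x) = x"
    using m mate_sym by metis
  show "partner (word e) x \<noteq> x" using m mate_irrefl by metis
  show "x < partner (word e) y \<and> partner (word e) y < partner (word e) x"
    if "x < y" "y < partner (word e) x"
    using mate_between[of "word e" x "partner (word e) x" y] that m by auto
qed

lemma mate_word: "mate (word e) i k \<longleftrightarrow> k = partner (word e) i"
  by (rule mate_iff_partner[OF matchable_word])

lemma component_restrict_noodle: "component (restrict_system (noodle u v) B) x = cluster B x"
proof -
  have "{(x, y). {x, y} \<in> pairs (fst (restrict_system (noodle u v) B)) \<union>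
      pairs (snd (restrict_system (noodle u v) B))} =
    {(p, q). p \<in> B \<and> q \<in> B \<and> (\<exists>e. q = partner (word e) p)}"
    using mate_word[of True] mate_word[of False] matchable_u matchable_v
    by (auto simp: restrict_system_def noodle_def pairs_restrict pairs_noodle word_def ex_bool_eq)
  then show ?thesis by (simp add: component_def cluster_def)
qed

lemma component_noodle: "component (noodle u v) x = cluster UNIV x"
proof -
  have "component (noodle u v) x = component (restrict_system (noodle u v) UNIV) x"
    by (simp add: component_def restrict_system_def restrict_matching_def)
  then show ?thesis by (simp add: component_restrict_noodle)
qed

lemma L0_iff: "L0 u v \<longleftrightarrow> cluster UNIV 0 \<subseteq> {0..}"
  by (auto simp: L0_def leftmost_def component_noodle)

lemma E_event_iff: "E_event k u v \<longleftrightarrow> \<not> cluster {..int k} 0 \<subseteq> {0..}"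
  by (auto simp: E_event_def leftmost_def component_restrict_noodle)

text \<open>A path from \<open>0\<close> to a negative point is finite, so it stays to the left of
  some bound \<open>k\<close>.\<close>

lemma not_L0_iff: "\<not> L0 u v \<longleftrightarrow> (\<exists>k. E_event k u v)"
proof
  assume "\<exists>k. E_event k u v"
  then show "\<not> L0 u v"
    unfolding L0_iff E_event_iff using cluster_mono[of 0 "{..int k}" UNIV for k] by force
next
  assume "\<not> L0 u v"
  then obtain j where j: "j \<in> cluster UNIV 0" "j < 0" unfolding L0_iff by force
  have "cluster UNIV 0 \<subseteq> {y. \<exists>k. y \<in> cluster {..int k} 0}"
  proof (rule cluster_subset_closed)
    fix y e assume "y \<in> {y. \<exists>k. y \<in> cluster {..int k} 0}"
    then obtain k where k: "y \<in> cluster {..int k} 0" by blast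
    let ?z = "partner (word e) y"
    let ?k = "max k (nat ?z)"
    have "cluster {..int k} 0 \<subseteq> cluster {..int ?k} 0" by (intro cluster_mono) auto
    then have "?z \<in> cluster {..int ?k} 0" using k by (intro cluster_step) auto
    then show "?z \<in> {y. \<exists>k. y \<in> cluster {..int k} 0}" by blast
  qed auto
  then show "\<exists>k. E_event k u v" unfolding E_event_iff using j by force
qed

text \<open>With the window ending at \<open>0\<close>, the first step decides: a letter
  \<open>R\<close> sends the path to the left, and two letters \<open>L\<close> leave
  \<open>0\<close> isolated.\<close>

lemma E_event_0_iff: "E_event 0 u v \<longleftrightarrow> u 0 = R \<or> v 0 = R"
proof -
  have lt: "0 < partner (word e) 0 \<longleftrightarrow> word e 0 = L" for e
    using mate_less[of "word e" 0 "partner (word e) 0"] mate_word by simp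
  have "cluster {..0} 0 \<subseteq> {0..} \<longleftrightarrow> (\<forall>e. word e 0 = L)"
  proof
    assume *: "cluster {..0} 0 \<subseteq> {0..}"
    show "\<forall>e. word e 0 = L"
    proof (rule ccontr)
      assume "\<not> ?thesis"
      then obtain e where "\<not> 0 < partner (word e) 0" using lt by blast
      then have "partner (word e) 0 \<in> cluster {..0} 0" "partner (word e) 0 < 0"
        using cluster_step[of 0 "{..0}" 0 e] no_fixpoint[of e 0]
        by (auto simp: not_less simp del: no_fixpoint)
      then show False using * by auto
    qed
  next
    assume "\<forall>e. word e 0 = L"
    then have "0 < partner (word e) 0" for e using lt by blast
    then have "cluster {..0} 0 \<subseteq> {0}"
      by (intro cluster_subset_closed) (auto simp: not_less[symmetric])
    then show "cluster {..0} 0 \<subseteq> {0..}" by auto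
  qed
  then show ?thesis unfolding E_event_iff by (auto simp: word_def all_bool_eq)
qed

lemma first_K_props:
  assumes "\<not> L0 u v"
  shows "E_event (first_K u v) u v" and "k < first_K u v \<Longrightarrow> \<not> E_event k u v"
proof -
  have "{k. E_event k u v} \<noteq> {}" using assms not_L0_iff by blast
  then show "E_event (first_K u v) u v" unfolding first_K_def using Inf_nat_def1[of "{k. E_event k u v}"] by simp
  show "k < first_K u v \<Longrightarrow> \<not> E_event k u v"
    unfolding first_K_def using cInf_lower[of k "{k. E_event k u v}"] by fastforce
qed

lemma first_K_0_iff: "\<not> L0 u v \<and> first_K u v = 0 \<longleftrightarrow> u 0 = R \<or> v 0 = R"
  using first_K_props not_L0_iff E_event_0_iff by (metis gr0I)

text \<open>The labels make \<open>0\<close> the first and \<open>K\<close> the last point, so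
  deleting the last label amounts to stopping the exploration before \<open>K\<close>. Connectedness
  of \<open>S\<close>, the absence of left exits of \<open>D\<close> and the two exits of
  \<open>S\<close> give the three defining conditions.\<close>

lemma partial_shape_in_partial_shapes:
  assumes nL0: "\<not> L0 u v" and K1: "1 \<le> first_K u v"
  shows "\<exists>k\<ge>1. partial_shape u v \<in> partial_shapes k"
proof -
  define K where "K = int (first_K u v)"
  define D where "D = cluster {0..K - 1} 0"
  define S where "S = cluster {0..K} 0"
  have "odd (card S) \<and> K \<in> S \<and>
    (\<forall>p\<in>D. \<forall>e. partner (word e) p \<in> D \<or> K \<le> partner (word e) p) \<and>
    (\<exists>x y a. exits S = {(y, a), (x, \<not> a)} \<and> K < partner (word a) y \<and> partner (word (\<not> a)) x < 0)"
    unfolding S_def D_def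
  proof (rule exits_first_escape)
    show "1 \<le> K" using K1 by (simp add: K_def)
    have "K - 1 = int (first_K u v - 1)" using K1 by (simp add: K_def)
    then show "cluster {..K - 1} 0 \<subseteq> {0..}"
      using first_K_props(2)[OF nL0, of "first_K u v - 1"] K1 unfolding E_event_iff by auto
    show "\<exists>j\<in>cluster {..K} 0. j < 0"
      using first_K_props(1)[OF nL0] unfolding E_event_iff K_def by force
  qed
  then obtain x y a where odd: "odd (card S)" and KS: "K \<in> S"
    and D_step: "\<And>p e. p \<in> D \<Longrightarrow> partner (word e) p \<in> D \<or> K \<le> partner (word e) p"
    and ex: "exits S = {(y, a), (x, \<not> a)}"
    and y: "K < partner (word a) y" and x: "partner (word (\<not> a)) x < 0"
    by blast
  have K0: "0 < K" using K1 by (simp add: K_def)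
  have S_sub: "S \<subseteq> {0..K}" and D_sub: "D \<subseteq> {0..K - 1}"
    unfolding S_def D_def using K0 by (intro cluster_subset; simp)+
  have fin: "finite S" using S_sub finite_subset by auto
  have S0: "0 \<in> S" and D0: "0 \<in> D" by (simp_all add: S_def D_def)
  have DS: "D \<subseteq> S" unfolding D_def S_def using K0 by (intro cluster_mono) auto
  have closed: "q \<in> S" if "p \<in> S" "q \<in> {0..K}" "mate (word e) p q" for p q e
    using cluster_step[of 0 "{0..K}" p e] that K0 unfolding S_def mate_word by auto
  \<comment> \<open>\<open>S\<close> contains the distinct points \<open>0\<close> and
    \<open>K\<close>, so its odd size is at least 3; this gives \<open>1 \<le> k\<close>.\<close>
  have "card {0, K} \<le> card S" using S0 KS fin by (intro card_mono) auto
  then have "2 \<le> card S" using K0 by simp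
  with odd obtain k where k: "card S = 2 * k + 1" "1 \<le> k"
    by (metis Suc_1 Suc_eq_plus1 Suc_leI Suc_le_mono add_0 gr0I mult_0_right not_less_eq_eq oddE)
  let ?A = "{0..<int (card S)}"
  have A: "?A = {0..2 * int k}" using k by auto
  define B where "B = {0..2 * int k - 1}"
  have BA: "B \<subseteq> ?A" using k by (auto simp: B_def)
  let ?g = "enum S"
  define P where "P = partial_shape u v"
  have "explored_points u v = S"
    by (simp add: explored_points_def component_restrict_noodle S_def K_def)
  then have P: "P = (canonical_matching ?A (relabel S u), canonical_matching ?A (relabel S v))"
    by (simp add: P_def partial_shape_def matching_of_word_eq Let_def)
  have mate_r: "mate (relabel S (word e)) i j \<longleftrightarrow> ?g j = partner (word e) (?g i)"
    if "i \<in> ?A" "j \<in> ?A" for i j e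
  proof -
    have "mate (relabel S (word e)) i j \<longleftrightarrow> mate (word e) (?g i) (?g j)"
      by (rule mate_relabel[OF matchable_word S_sub _ that]) (rule closed)
    then show ?thesis by (simp only: mate_word)
  qed
  define Rel where "Rel C = {(i, j). i \<in> C \<and> j \<in> C \<and> (\<exists>e. ?g j = partner (word e) (?g i))}" for C
  have comp: "component (canonical_matching C (relabel S u), canonical_matching C (relabel S v)) i =
      {j. (i, j) \<in> (Rel C)\<^sup>*}" if "C \<subseteq> ?A" for C i
  proof -
    have "mate (relabel S u) i j \<longleftrightarrow> ?g j = partner (word True) (?g i)"
      "mate (relabel S v) i j \<longleftrightarrow> ?g j = partner (word False) (?g i)"
      if "i \<in> C" "j \<in> C" for i j
      using mate_r[of i j True] mate_r[of i j False] subsetD[OF \<open>C \<subseteq> ?A\<close>] that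
      by (simp_all add: word_def)
    then have "{(x, y). {x, y} \<in> pairs (canonical_matching C (relabel S u)) \<union>
        pairs (canonical_matching C (relabel S v))} = Rel C"
      unfolding Rel_def by (auto simp: pairs_canonical ex_bool_eq)
    then show ?thesis by (simp add: component_def)
  qed
  have A0: "0 \<in> ?A" using k by simp
  have g0: "?g 0 = 0"
  proof -
    obtain i where i: "i \<in> ?A" "?g i = 0" using enum_surj[OF fin S0] .
    have "?g 0 \<ge> 0" using enum_mem[OF fin A0] S_sub by auto
    then have "\<not> ?g 0 < ?g i" using i by simp
    then have "i = 0" using enum_less_iff[OF fin A0 i(1)] i(1) by auto
    then show ?thesis using i by simp
  qed
  have gK: "?g (2 * int k) = K"
  proof -
    have kA: "2 * int k \<in> ?A" unfolding A by simp
    obtain i where i: "i \<in> ?A" "?g i = K" using enum_surj[OF fin KS] .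
    have "?g (2 * int k) \<le> K" using enum_mem[OF fin kA] S_sub by auto
    then have "\<not> ?g i < ?g (2 * int k)" using i by simp
    then have "i = 2 * int k" using enum_less_iff[OF fin i(1) kA] i(1) unfolding A by auto
    then show ?thesis using i by simp
  qed
  have gB: "?g i < K" if "i \<in> B" for i
    using that enum_less_iff[OF fin, of i "2 * int k"] gK BA unfolding A by (auto simp: B_def)
  have B_iff: "i \<in> B" if "i \<in> ?A" "?g i < K" for i
    using that gK unfolding A B_def by (cases "i = 2 * int k") auto

  \<comment> \<open>Arcs used by the exploration join points of \<open>S\<close>, so they survive
    relabelling and connect every label to \<open>0\<close>.\<close>
  have "S \<subseteq> {p \<in> S. \<forall>j\<in>?A. ?g j = p \<longrightarrow> (0, j) \<in> (Rel ?A)\<^sup>*}"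
    unfolding S_def
  proof (rule cluster_subset_closed, fold S_def)
    show "0 \<in> {p \<in> S. \<forall>j\<in>?A. ?g j = p \<longrightarrow> (0, j) \<in> (Rel ?A)\<^sup>*}"
      using S0 g0 enum_eq_iff[OF fin A0] by fastforce
    fix p e assume p: "p \<in> {p \<in> S. \<forall>j\<in>?A. ?g j = p \<longrightarrow> (0, j) \<in> (Rel ?A)\<^sup>*}"
      and q: "partner (word e) p \<in> {0..K}"
    obtain i where i: "i \<in> ?A" "?g i = p" using p enum_surj[OF fin] by blast
    then have "(0, i) \<in> (Rel ?A)\<^sup>*" using p by blast
    moreover have "(i, j) \<in> Rel ?A" if "j \<in> ?A" "?g j = partner (word e) p" for j
      using i that unfolding Rel_def by blast
    moreover have "partner (word e) p \<in> S" using closed[of p _ e] p q by (simp add: mate_word)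
    ultimately show "partner (word e) p \<in> {p \<in> S. \<forall>j\<in>?A. ?g j = p \<longrightarrow> (0, j) \<in> (Rel ?A)\<^sup>*}"
      by (auto intro: rtrancl_into_rtrancl)
  qed
  then have conn: "(0, j) \<in> (Rel ?A)\<^sup>*" if "j \<in> ?A" for j using that enum_mem[OF fin] by blast
  have "(j, i) \<in> Rel ?A" if ij: "(i, j) \<in> Rel ?A" for i j
  proof -
    obtain e where "i \<in> ?A" "j \<in> ?A" "?g j = partner (word e) (?g i)" using ij by (auto simp: Rel_def)
    moreover then have "?g i = partner (word e) (?g j)" by (simp only: invol)
    ultimately show ?thesis by (auto simp: Rel_def)
  qed
  then have "sym ((Rel ?A)\<^sup>*)" by (intro sym_rtrancl symI)
  then have conn_rev: "(j, 0) \<in> (Rel ?A)\<^sup>*" if "j \<in> ?A" for j using conn[OF that] by (rule symD)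
  have comp_P: "component P i = {j. (i, j) \<in> (Rel ?A)\<^sup>*}" for i
    unfolding P by (rule comp) (rule order_refl)
  have "component P j = component P 0" if j: "j \<in> ?A" for j
    unfolding comp_P using conn[OF j] conn_rev[OF j]
    by (intro Collect_cong iffI) (rule rtrancl_trans, assumption, assumption)+
  then have "component P ` ?A = (\<lambda>_. component P 0) ` ?A" by (intro image_cong refl)
  also have "\<dots> = {component P 0}" using A0 by (intro image_constant)
  finally have "component P ` ?A = {component P 0}" .
  then have one: "card (component P ` ?A) = 1" by simp
  have meander: "partial_meander_on {0..2 * int k} P"
    using one encoded_by_canonical[of "{0..2 * int k}"]
    unfolding partial_meander_on_def partial_meandric_system_on_def P A by (auto simp: encoded_by_def)

  let ?Q = "restrict_system P {0..2 * int k - 1}"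
  have Q: "?Q = (canonical_matching B (relabel S u), canonical_matching B (relabel S v))"
    unfolding P restrict_system_def using BA by (simp add: restrict_canonical B_def)
  have Q_comp: "j \<in> B \<and> ?g j \<in> D" if "j \<in> component ?Q 0" for j
  proof -
    have "(0, j) \<in> (Rel B)\<^sup>*" using that unfolding Q comp[OF BA] by simp
    then show ?thesis
    proof induction
      case base
      then show ?case using g0 D0 k by (simp add: B_def)
    next
      case (step i j)
      then show ?case using D_step gB[of j] unfolding Rel_def by fastforce
    qed
  qed
  \<comment> \<open>A point of \<open>D\<close> with letter \<open>R\<close> has its partner to its
    left. As \<open>D\<close> has no exit to the left, the partner lies in \<open>D\<close>, hence
    has a label in \<open>B\<close>, and the point is not a singleton.\<close>
  have no_R: "deco (canonical_matching B (relabel S (word e))) j \<noteq> Some R" if "j \<in> component ?Q 0" for e j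
  proof
    assume R: "deco (canonical_matching B (relabel S (word e))) j = Some R"
    have j: "j \<in> B" "?g j \<in> D" using Q_comp[OF that] by auto
    have wR: "word e (?g j) = R" using R by (auto simp: deco_canonical relabel_def split: if_splits)
    let ?q = "partner (word e) (?g j)"
    have "\<not> ?g j < ?q" using mate_less[of "word e" "?g j" ?q] wR by (simp add: mate_word)
    then have q: "?q \<in> D" using D_step[OF j(2), of e] gB[OF j(1)] by auto
    then obtain l where l: "l \<in> ?A" "?g l = ?q" using enum_surj[OF fin] DS by blast
    then have "l \<in> B" using B_iff[of l] q D_sub by auto
    moreover have "mate (relabel S (word e)) j l" using mate_r[of j l e] j l BA by auto
    ultimately show False using R by (auto simp: deco_canonical split: if_splits)
  qed
  have no_R': "\<not> (\<exists>j\<in>component ?Q 0. deco (fst ?Q) j = Some R \<or> deco (snd ?Q) j = Some R)"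
    using no_R[of _ True] no_R[of _ False] unfolding Q by (auto simp: word_def)

  \<comment> \<open>The unmatched labels on side \<open>e\<close> are the exits of \<open>S\<close>
    on that side; there is exactly one, so the decoration has a single entry.\<close>
  have deco: "\<exists>i. deco (canonical_matching ?A (relabel S (word e))) = [i \<mapsto> word e z]"
    if z: "\<And>p. (p, e) \<in> exits S \<longleftrightarrow> p = z" for e z
  proof -
    have "z \<in> S" using z[of z] by (simp add: exits_def)
    then obtain i where i: "i \<in> ?A" "?g i = z" using enum_surj[OF fin] by blast
    have un: "\<not> (\<exists>l\<in>?A. mate (relabel S (word e)) j l) \<longleftrightarrow> j = i" if j: "j \<in> ?A" for j
    proof -
      have "(\<exists>l\<in>?A. mate (relabel S (word e)) j l) \<longleftrightarrow> partner (word e) (?g j) \<in> S"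
        using mate_r[OF j, of _ e] enum_mem[OF fin] enum_surj[OF fin] by metis
      also have "\<dots> \<longleftrightarrow> (?g j, e) \<notin> exits S" using enum_mem[OF fin j] by (simp add: exits_def)
      also have "\<dots> \<longleftrightarrow> j \<noteq> i" using z enum_eq_iff[OF fin j i(1)] i(2) by simp
      finally show ?thesis by blast
    qed
    have "deco (canonical_matching ?A (relabel S (word e))) j = [i \<mapsto> word e z] j" for j
      using i un[of j] by (auto simp: deco_canonical relabel_def)
    then show ?thesis by blast
  qed
  obtain i j where ij: "deco (canonical_matching ?A (relabel S (word a))) = [i \<mapsto> word a y]"
    "deco (canonical_matching ?A (relabel S (word (\<not> a)))) = [j \<mapsto> word (\<not> a) x]"
    using deco[of a y] deco[of "\<not> a" x] ex by auto
  have "y \<in> S" "x \<in> S" using ex by (auto simp: exits_def set_eq_iff)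
  \<comment> \<open>The exit at \<open>y\<close> goes to the right and the one at \<open>x\<close>
    to the left, which fixes their letters.\<close>
  then have "word a y = L" "word (\<not> a) x = R"
    using mate_less[of "word a" y "partner (word a) y"]
      mate_less[of "word (\<not> a)" x "partner (word (\<not> a)) x"] x y S_sub by (force simp: mate_word)+
  with ij have singles: "\<exists>i j b c. deco (fst P) = [i \<mapsto> b] \<and> deco (snd P) = [j \<mapsto> c] \<and> {b, c} = {L, R}"
    unfolding P by (cases a) (auto simp: word_def)
  show ?thesis
    using meander no_R' singles k(2) unfolding partial_shapes_def Let_def P_def by blast
qed

end

text \<open>The pairs and singletons of a shape cover exactly \<open>{0..2 * int k}\<close>, so the
  shape determines \<open>k\<close>.\<close>

lemma partial_shapes_disjoint:
  assumes "P \<in> partial_shapes k" "P \<in> partial_shapes k'"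
  shows "k = k'"
proof -
  have "\<Union> (pairs (fst P) \<union> (\<lambda>i. {i}) ` dom (deco (fst P))) = {0..2 * int j}" if "P \<in> partial_shapes j" for j
    using that unfolding partial_shapes_def partial_meander_on_def partial_meandric_system_on_def
      partial_matching_on_def partition_on_def by simp
  then have "{0..2 * int k} = {0..2 * int k'}" using assms by metis
  then show ?thesis by simp
qed

section \<open>Almost sure matchability\<close>

definition coin :: "letter pmf" where
  "coin = pmf_of_set {L, R}"

text \<open>Both words form one family, \<open>Inl\<close> indexing the upper and \<open>Inr\<close>
  the lower one, so that independence of all letters is a single product measure.\<close>

definition fair_words :: "(int + int \<Rightarrow> letter) measure" where
  "fair_words = PiM UNIV (\<lambda>_. measure_pmf coin)"

lemma measure_coin: "measure (measure_pmf coin) {l} = 1 / 2"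
  by (cases l) (simp_all add: coin_def measure_pmf_single pmf_of_set)

lemma product_prob_space_coin: "product_prob_space (\<lambda>_ :: int + int. measure_pmf coin)"
  by (intro product_prob_spaceI prob_space_measure_pmf)

lemma prob_space_fair_words: "prob_space fair_words"
  unfolding fair_words_def by (intro prob_space_PiM prob_space_measure_pmf)

lemma space_fair_words [simp]: "space fair_words = UNIV"
  by (simp add: fair_words_def space_PiM PiE_UNIV_domain)

lemma finite_letters: "finite (UNIV :: letter set)"
proof -
  have "(UNIV :: letter set) = {L, R}" using letter.exhaust by auto
  then show ?thesis by (metis finite.emptyI finite.insertI)
qed

lemma pred_letter: "Measurable.pred fair_words (\<lambda>w. w i = l)"
proof -
  have "(\<lambda>w. w i) \<in> measurable fair_words (measure_pmf coin)"
    unfolding fair_words_def by (rule measurable_component_singleton) simp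
  then have "(\<lambda>w. w i) \<in> measurable fair_words (count_space UNIV)" by simp
  then show ?thesis by measurable
qed

text \<open>Over a finite alphabet, a property of finitely many letters is a finite union of
  cylinders. The other measurability proofs are built on this.\<close>

lemma pred_finite_dependence:
  assumes J: "finite J" and dep: "\<And>w w'. (\<And>j. j \<in> J \<Longrightarrow> w j = w' j) \<Longrightarrow> P w = P w'"
  shows "Measurable.pred fair_words P"
proof -
  let ?X = "{x \<in> PiE J (\<lambda>_. UNIV). P x}"
  have fin: "finite ?X" using finite_PiE[OF J, of "\<lambda>_. UNIV :: letter set"] finite_letters by auto
  have iff: "P w \<longleftrightarrow> (\<exists>x\<in>?X. \<forall>j\<in>J. w j = x j)" for w
  proof
    assume "P w"
    moreover have "P w = P (restrict w J)" by (rule dep) simp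
    ultimately have "restrict w J \<in> ?X" by (simp add: restrict_PiE_iff)
    then show "\<exists>x\<in>?X. \<forall>j\<in>J. w j = x j" by (rule bexI[rotated]) simp
  next
    assume "\<exists>x\<in>?X. \<forall>j\<in>J. w j = x j"
    then obtain x where x: "P x" "\<forall>j\<in>J. w j = x j" by blast
    have "P w = P x" by (rule dep) (use x(2) in blast)
    then show "P w" using x(1) by blast
  qed
  have "Measurable.pred fair_words (\<lambda>w. \<exists>x\<in>?X. \<forall>j\<in>J. w j = x j)"
    using fin J by (intro pred_intros_finite pred_letter)
  then show ?thesis unfolding iff[symmetric] .
qed

lemma prob_cylinder:
  assumes "finite J"
  shows "measure fair_words {w. \<forall>j\<in>J. w j = x j} = (1 / 2) ^ card J"
proof -
  interpret product_prob_space "\<lambda>_ :: int + int. measure_pmf coin" UNIV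
    by (rule product_prob_space_coin)
  have "emeasure fair_words {w. \<forall>j\<in>J. w j = x j} = (\<Prod>j\<in>J. emeasure (measure_pmf coin) {x j})"
    using emeasure_PiM_Collect[of J "\<lambda>j. {x j}"] assms
    by (simp add: fair_words_def[symmetric])
  also have "\<dots> = (\<Prod>j\<in>J. ennreal (1 / 2))"
    by (intro prod.cong refl) (metis measure_coin measure_pmf.emeasure_eq_measure)
  also have "\<dots> = ennreal ((1 / 2) ^ card J)"
    by (simp only: prod_constant) (rule ennreal_power, simp)
  finally show ?thesis by (simp add: measure_def)
qed

text \<open>\<open>c\<close> gives the order in which letters are read and \<open>l\<close> is the
  letter that counts as a step up, so walks to the right and, with \<open>R\<close> as step up, to
  the left are treated at once. Only heights after a step must be positive, so the walk may start at
  height \<open>0\<close>.\<close>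

definition survives :: "letter \<Rightarrow> (nat \<Rightarrow> int + int) \<Rightarrow> nat \<Rightarrow> int \<Rightarrow> (int + int \<Rightarrow> letter) \<Rightarrow> bool" where
  "survives l c n h w \<longleftrightarrow> (\<forall>t<n. 0 < h + (\<Sum>s\<le>t. if w (c s) = l then 1 else -1))"

fun survival_prob :: "nat \<Rightarrow> int \<Rightarrow> real" where
  "survival_prob 0 h = 1"
| "survival_prob (Suc n) h =
     ((if 0 < h + 1 then survival_prob n (h + 1) else 0) +
      (if 0 < h - 1 then survival_prob n (h - 1) else 0)) / 2"

lemma survives_Suc:
  fixes h :: int and l :: letter and c :: "nat \<Rightarrow> int + int"
  defines "e \<equiv> \<lambda>w. if w (c 0) = l then 1 else -1 :: int"
  shows "survives l c (Suc n) h w \<longleftrightarrow> 0 < h + e w \<and> survives l (c \<circ> Suc) n (h + e w) w"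
proof -
  have "h + (\<Sum>s\<le>Suc t. if w (c s) = l then 1 else -1) =
      h + e w + (\<Sum>s\<le>t. if w ((c \<circ> Suc) s) = l then 1 else -1)" for t
    by (simp add: sum.atMost_Suc_shift e_def del: sum.atMost_Suc)
  then show ?thesis
    unfolding survives_def All_less_Suc2 by (simp add: e_def algebra_simps del: sum.atMost_Suc)
qed

lemma survives_cong:
  assumes "\<And>t. t < n \<Longrightarrow> w (c t) = w' (c t)"
  shows "survives l c n h w = survives l c n h w'"
proof -
  have "(\<Sum>s\<le>t. if w (c s) = l then 1 else -1 :: int) = (\<Sum>s\<le>t. if w' (c s) = l then 1 else -1)"
    if "t < n" for t using that assms by (intro sum.cong) auto
  then show ?thesis unfolding survives_def by simp
qed

text \<open>The set \<open>J\<close> of prescribed letters makes the induction work: splitting on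
  the first letter read moves \<open>c 0\<close> into \<open>J\<close>, which stays disjoint from
  the remaining reading order.\<close>

lemma prob_survives:
  assumes "inj c" "finite J" "J \<inter> range c = {}"
  shows "measure fair_words {w. (\<forall>j\<in>J. w j = x j) \<and> survives l c n h w} =
    (1 / 2) ^ card J * survival_prob n h"
  using assms
proof (induction n arbitrary: c J x h)
  case 0
  then show ?case by (simp add: survives_def prob_cylinder)
next
  case (Suc n)
  interpret prob_space fair_words by (rule prob_space_fair_words)
  obtain l' where l': "l' \<noteq> l" by (metis letter.distinct(1))
  have two: "l1 \<noteq> l \<longleftrightarrow> l1 = l'" for l1 using l' by (cases l1; cases l; cases l') auto
  let ?J = "insert (c 0) J"
  let ?C = "\<lambda>a h'. {w. (\<forall>j\<in>?J. w j = (x(c 0 := a)) j) \<and> survives l (c \<circ> Suc) n h' w}"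
  have c0: "c 0 \<notin> J" using Suc.prems by blast
  have "?J \<inter> range (c \<circ> Suc) = {}" using Suc.prems by (auto dest: injD)
  then have IH: "measure fair_words (?C a h') = (1 / 2) ^ Suc (card J) * survival_prob n h'" for a h'
  proof -
    have "measure fair_words (?C a h') = (1 / 2) ^ card ?J * survival_prob n h'"
      by (rule Suc.IH) (use Suc.prems \<open>?J \<inter> range (c \<circ> Suc) = {}\<close> inj_compose[OF Suc.prems(1) inj_Suc] in \<open>simp_all add: comp_def\<close>)
    then show ?thesis using Suc.prems c0 by simp
  qed
  have J: "(\<forall>j\<in>?J. w j = (x(c 0 := a)) j) \<longleftrightarrow> (\<forall>j\<in>J. w j = x j) \<and> w (c 0) = a" for w a
    using c0 by auto
  have "Measurable.pred fair_words (\<lambda>w. (\<forall>j\<in>?J. w j = (x(c 0 := a)) j) \<and> survives l (c \<circ> Suc) n h' w)"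
    for a h'
  proof (rule pred_finite_dependence)
    show "finite (?J \<union> (c \<circ> Suc) ` {..<n})" using Suc.prems by simp
    fix w w' :: "int + int \<Rightarrow> letter" assume *: "\<And>j. j \<in> ?J \<union> (c \<circ> Suc) ` {..<n} \<Longrightarrow> w j = w' j"
    have "survives l (c \<circ> Suc) n h' w = survives l (c \<circ> Suc) n h' w'"
      by (rule survives_cong) (rule *, simp)
    moreover have "(\<forall>j\<in>?J. w j = (x(c 0 := a)) j) \<longleftrightarrow> (\<forall>j\<in>?J. w' j = (x(c 0 := a)) j)"
      using * by simp
    ultimately show "((\<forall>j\<in>?J. w j = (x(c 0 := a)) j) \<and> survives l (c \<circ> Suc) n h' w) =
        ((\<forall>j\<in>?J. w' j = (x(c 0 := a)) j) \<and> survives l (c \<circ> Suc) n h' w')"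
      by blast
  qed
  then have meas: "?C a h' \<in> sets fair_words" for a h'
    by (simp add: pred_def)
  let ?U = "if 0 < h + 1 then ?C l (h + 1) else {}"
  let ?D = "if 0 < h - 1 then ?C l' (h - 1) else {}"
  have "{w. (\<forall>j\<in>J. w j = x j) \<and> survives l c (Suc n) h w} = ?U \<union> ?D"
    unfolding survives_Suc J using two by (auto split: if_splits)
  moreover have "measure fair_words (?U \<union> ?D) = measure fair_words ?U + measure fair_words ?D"
    using meas l' by (intro finite_measure_Union) (auto simp: J)
  ultimately show ?case using IH by (auto simp: field_simps)
qed

lemma survival_prob_bounds: "0 \<le> survival_prob n h" "survival_prob n h \<le> 1"
proof -
  have "0 \<le> survival_prob n h \<and> survival_prob n h \<le> 1"
  proof (induction n arbitrary: h)
    case (Suc n)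
    have mean: "0 \<le> (a + b) / 2 \<and> (a + b) / 2 \<le> 1" if "0 \<le> a" "a \<le> 1" "0 \<le> b" "b \<le> 1" for a b :: real
      using that by simp
    show ?case unfolding survival_prob.simps by (rule mean) (use Suc in auto)
  qed simp
  then show "0 \<le> survival_prob n h" "survival_prob n h \<le> 1" by auto
qed

lemma survival_prob_antimono: "survival_prob (Suc n) h \<le> survival_prob n h"
proof (induction n arbitrary: h)
  case (Suc n)
  show ?case using Suc[of "h + 1"] Suc[of "h - 1"] by (simp del: survival_prob.simps add: survival_prob.simps(2)[of _ h])
qed simp

text \<open>The limit is bounded and, as a function of the starting height, harmonic for the walk killed
  at height \<open>0\<close>. Hence it is linear on positive heights, and therefore \<open>0\<close>.\<close>

lemma survival_prob_tendsto: "(\<lambda>n. survival_prob n 0) \<longlonglongrightarrow> 0"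
proof -
  have "\<exists>q. (\<lambda>n. survival_prob n h) \<longlonglongrightarrow> q" for h
  proof -
    have "decseq (\<lambda>n. survival_prob n h)" by (rule decseq_SucI) (rule survival_prob_antimono)
    then show ?thesis using decseq_convergent[of _ 0] survival_prob_bounds(1) by metis
  qed
  then obtain q where q: "\<And>h. (\<lambda>n. survival_prob n h) \<longlonglongrightarrow> q h" by metis
  have q01: "0 \<le> q h" "q h \<le> 1" for h
    using LIMSEQ_le_const[OF q, of 0 h] LIMSEQ_le_const2[OF q, of h 1] survival_prob_bounds by auto
  have rec: "q h = ((if 0 < h + 1 then q (h + 1) else 0) + (if 0 < h - 1 then q (h - 1) else 0)) / 2" for h
  proof -
    have "(\<lambda>n. survival_prob (Suc n) h) \<longlonglongrightarrow>
        ((if 0 < h + 1 then q (h + 1) else 0) + (if 0 < h - 1 then q (h - 1) else 0)) / 2"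
      by (simp only: survival_prob.simps) (auto intro!: tendsto_intros q)
    moreover have "(\<lambda>n. survival_prob (Suc n) h) \<longlonglongrightarrow> q h" using q by (rule LIMSEQ_Suc)
    ultimately show ?thesis using LIMSEQ_unique by blast
  qed
  have lin: "q (int n + 1) = (real n + 1) * q 1 \<and> q (int n + 2) = (real n + 2) * q 1" for n
  proof (induction n)
    case 0
    show ?case using rec[of 1] by simp
  next
    case (Suc n)
    have "q (int n + 3) = 2 * q (int n + 2) - q (int n + 1)"
      using rec[of "int n + 2"] by (simp add: algebra_simps)
    then show ?case using Suc by (simp add: algebra_simps)
  qed
  have "q 1 = 0"
  proof (rule ccontr)
    assume "q 1 \<noteq> 0"
    then have "0 < q 1" using q01(1)[of 1] by simp
    then obtain n where "1 < real n * q 1" using reals_Archimedean3 by blast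
    then have "1 < (real n + 1) * q 1" using \<open>0 < q 1\<close> by (simp add: algebra_simps)
    then show False using lin[of n] q01(2)[of "int n + 1"] by simp
  qed
  \<comment> \<open>From height \<open>0\<close> only the step up survives, so \<open>q 0\<close> is
    half of \<open>q 1\<close>.\<close>
  then have "q 0 = 0" using rec[of 0] by simp
  then show ?thesis using q[of 0] by simp
qed

text \<open>Staying positive forever means surviving \<open>n\<close> steps for every
  \<open>n\<close>, and these probabilities tend to 0.\<close>

lemma AE_walk_returns:
  fixes c :: "nat \<Rightarrow> int + int"
  assumes "inj c"
  shows "AE w in fair_words. \<exists>t. (\<Sum>s\<le>t. if w (c s) = l then 1 else -1 :: int) \<le> 0"
proof -
  interpret prob_space fair_words by (rule prob_space_fair_words)
  have prob: "prob {w. survives l c n 0 w} = survival_prob n 0" for n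
    using prob_survives[OF assms, of "{}" undefined l n 0] by simp
  have meas: "Measurable.pred fair_words (\<lambda>w. survives l c n 0 w)" for n
  proof (rule pred_finite_dependence)
    show "survives l c n 0 w = survives l c n 0 w'" if "\<And>j. j \<in> c ` {..<n} \<Longrightarrow> w j = w' j" for w w'
      by (rule survives_cong) (rule that, simp)
  qed simp
  have "prob {w. \<forall>n. survives l c n 0 w} \<le> survival_prob n 0" for n
    using meas[of n] unfolding prob[symmetric] by (intro finite_measure_mono) (auto simp: pred_def)
  then have "prob {w. \<forall>n. survives l c n 0 w} \<le> 0"
    using LIMSEQ_le_const[OF survival_prob_tendsto] by blast
  then have "prob {w. \<forall>n. survives l c n 0 w} = 0" using measure_nonneg antisym by blast
  moreover have "Measurable.pred fair_words (\<lambda>w. \<forall>n. survives l c n 0 w)"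
    by (intro pred_intros_countable meas)
  then have "{w. \<forall>n. survives l c n 0 w} \<in> sets fair_words" by (simp add: pred_def)
  ultimately have "AE w in fair_words. w \<notin> {w. \<forall>n. survives l c n 0 w}"
    by (subst (asm) prob_eq_0) auto
  then show ?thesis
    by (rule AE_mp) (auto simp: survives_def not_less intro!: AE_I2)
qed

lemma height_add_nat: "height w i (i + int t) = (\<Sum>s\<le>t. step (w (i + int s)))"
proof (induction t)
  case (Suc t)
  then show ?case using height_last[of i "i + int (Suc t)" w] by (simp add: algebra_simps)
qed simp

lemma height_diff_nat: "height w (i - int t) i = (\<Sum>s\<le>t. step (w (i - int s)))"
proof (induction t)
  case (Suc t)
  then show ?case using height_first[of "i - int (Suc t)" i w] by (simp add: algebra_simps)
qed simp

text \<open>An \<open>L\<close> looks for its mate to the right and an \<open>R\<close> to the left.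
  In the second case \<open>R\<close> is the step up, so the height changes sign.\<close>

lemma AE_matchable:
  assumes "inj c"
  shows "AE w in fair_words. matchable (w \<circ> c)"
proof -
  have "AE w in fair_words. \<exists>k. mate (w \<circ> c) i k" for i
  proof -
    have "inj (\<lambda>s. c (i + int s))" "inj (\<lambda>s. c (i - int s))"
      using assms by (auto intro!: injI dest: injD)
    from AE_walk_returns[OF this(1), of L] AE_walk_returns[OF this(2), of R]
    show ?thesis
    proof eventually_elim
      case (elim w)
      show ?case
      proof (cases "(w \<circ> c) i")
        case L
        obtain t where "(\<Sum>s\<le>t. if w (c (i + int s)) = L then 1 else -1 :: int) \<le> 0"
          using elim(1) by blast
        then have "height (w \<circ> c) i (i + int t) \<le> 0"
          unfolding height_add_nat by (simp add: step_def)
        then show ?thesis using ex_matched_right[of "w \<circ> c" i "i + int t"] L by (auto simp: mate_def)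
      next
        case R
        obtain t where "(\<Sum>s\<le>t. if w (c (i - int s)) = R then 1 else -1 :: int) \<le> 0"
          using elim(2) by blast
        moreover have "step a = - (if a = R then 1 else -1)" for a by (cases a) auto
        then have "height (w \<circ> c) (i - int t) i =
            - (\<Sum>s\<le>t. if w (c (i - int s)) = R then 1 else -1)"
          unfolding height_diff_nat by (simp add: sum_negf)
        ultimately have "0 \<le> height (w \<circ> c) (i - int t) i" by simp
        then show ?thesis using ex_matched_left[of "w \<circ> c" i "i - int t"] R by (auto simp: mate_def)
      qed
    qed
  qed
  then show ?thesis unfolding matchable_def by (simp add: AE_all_countable)
qed

section \<open>Measurability and mass transport\<close>

abbreviation noodle_of :: "(int + int \<Rightarrow> letter) \<Rightarrow> meandric_system" where
  "noodle_of w \<equiv> noodle (w \<circ> Inl) (w \<circ> Inr)"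

lemma pred_mate: "Measurable.pred fair_words (\<lambda>w. mate (w \<circ> c) i k)"
proof (rule pred_finite_dependence)
  show "finite (c ` ({i..k} \<union> {k..i}))" by simp
  show "mate (w \<circ> c) i k = mate (w' \<circ> c) i k"
    if "\<And>j. j \<in> c ` ({i..k} \<union> {k..i}) \<Longrightarrow> w j = w' j" for w w'
  proof -
    have "matched (w \<circ> c) i k = matched (w' \<circ> c) i k" "matched (w \<circ> c) k i = matched (w' \<circ> c) k i"
      using that by (auto intro!: matched_cong)
    then show ?thesis by (simp add: mate_def)
  qed
qed

lemma pred_matchable: "Measurable.pred fair_words (\<lambda>w. matchable (w \<circ> c))"
  unfolding matchable_def by (intro pred_intros_countable pred_mate)

lemma pred_pairs_noodle: "Measurable.pred fair_words (\<lambda>w. {i, k} \<in> pairs (noodle_matching (w \<circ> c)))"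
  unfolding pairs_noodle by (intro pred_intros_logic pred_matchable pred_mate)

text \<open>Paths have finite length and integer intermediate points, so reachability is a countable
  combination of edge events.\<close>

lemma pred_rtrancl:
  fixes R :: "'a \<Rightarrow> (int \<times> int) set"
  assumes "\<And>x y. Measurable.pred N (\<lambda>w. (x, y) \<in> R w)"
  shows "Measurable.pred N (\<lambda>w. (x, y) \<in> (R w)\<^sup>*)"
proof -
  have "Measurable.pred N (\<lambda>w. (x, y) \<in> R w ^^ n)" for n y
  proof (induction n arbitrary: y)
    case 0
    then show ?case by simp
  next
    case (Suc n)
    have "(x, y) \<in> R w ^^ Suc n \<longleftrightarrow> (\<exists>z. (x, z) \<in> R w ^^ n \<and> (z, y) \<in> R w)" for w by auto
    then show ?case using Suc assms by (simp only:) (intro pred_intros_countable pred_intros_logic)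
  qed
  then have "Measurable.pred N (\<lambda>w. \<exists>n. (x, y) \<in> R w ^^ n)" by (intro pred_intros_countable)
  then show ?thesis by (simp add: rtrancl_power)
qed

lemma pred_component_restrict:
  "Measurable.pred fair_words (\<lambda>w. j \<in> component (restrict_system (noodle_of w) B) i)"
  unfolding component_def mem_Collect_eq
proof (rule pred_rtrancl)
  fix x y
  have "Measurable.pred fair_words (\<lambda>w. (x \<in> B \<and> y \<in> B \<and> {x, y} \<in> pairs (noodle_matching (w \<circ> Inl))) \<or>
      (x \<in> B \<and> y \<in> B \<and> {x, y} \<in> pairs (noodle_matching (w \<circ> Inr))))"
    by (intro pred_intros_logic pred_pairs_noodle measurable_const) simp_all
  then show "Measurable.pred fair_words (\<lambda>w. (x, y) \<in> {(x, y). {x, y} \<in>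
      pairs (fst (restrict_system (noodle_of w) B)) \<union> pairs (snd (restrict_system (noodle_of w) B))})"
    by (simp add: restrict_system_def noodle_def pairs_restrict)
qed

lemma component_restrict_UNIV: "component (restrict_system M UNIV) = component M"
  by (simp add: component_def restrict_system_def restrict_matching_def fun_eq_iff)

lemma pred_component: "Measurable.pred fair_words (\<lambda>w. j \<in> component (noodle_of w) i)"
  using pred_component_restrict[of j UNIV i] by (simp add: component_restrict_UNIV)

lemma pred_leftmost: "Measurable.pred fair_words (\<lambda>w. leftmost (noodle_of w) i)"
  unfolding leftmost_def Ball_def
  by (intro pred_intros_countable pred_intros_logic pred_component measurable_const) simp_all

lemma pred_L0: "Measurable.pred fair_words (\<lambda>w. L0 (w \<circ> Inl) (w \<circ> Inr))"
  unfolding L0_def by (rule pred_leftmost)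

lemma pred_E_event: "Measurable.pred fair_words (\<lambda>w. E_event k (w \<circ> Inl) (w \<circ> Inr))"
  unfolding E_event_def leftmost_def Ball_def
  by (intro pred_intros_countable pred_intros_logic pred_component_restrict measurable_const) simp_all

text \<open>\<open>Inf {}\<close> is carried along unevaluated as a constant, which makes
  \<open>first_K\<close> measurable also where no \<open>E_event\<close> occurs.\<close>

lemma Inf_nat_eq_iff:
  fixes X :: "nat set"
  shows "Inf X = m \<longleftrightarrow> (m \<in> X \<and> (\<forall>k<m. k \<notin> X)) \<or> ((\<forall>k. k \<notin> X) \<and> Inf {} = m)"
proof (cases "X = {}")
  case False
  have "m \<in> X \<and> (\<forall>k<m. k \<notin> X)" if "Inf X = m"
    using that Inf_nat_def1[OF False] cInf_lower[of _ X] by fastforce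
  moreover have "Inf X = m" if "m \<in> X" "\<forall>k<m. k \<notin> X"
    using that cInf_lower[of m X] Inf_nat_def1[OF False] by (metis bdd_below_bot le_neq_implies_less)
  ultimately show ?thesis using False by blast
qed auto

lemma pred_first_K: "Measurable.pred fair_words (\<lambda>w. first_K (w \<circ> Inl) (w \<circ> Inr) = m)"
proof -
  let ?E = "\<lambda>k w. E_event k (w \<circ> Inl) (w \<circ> Inr)"
  have "first_K (w \<circ> Inl) (w \<circ> Inr) = m \<longleftrightarrow>
      (?E m w \<and> (\<forall>k. k < m \<longrightarrow> \<not> ?E k w)) \<or> ((\<forall>k. \<not> ?E k w) \<and> Inf {} = m)" for w
    unfolding first_K_def by (subst Inf_nat_eq_iff) simp
  then show ?thesis
    by (simp only:) (intro pred_intros_countable pred_intros_logic pred_E_event measurable_const, simp_all)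
qed

lemma component_restrict_subset: "component (restrict_system M B) i \<subseteq> insert i B"
proof
  fix j assume "j \<in> component (restrict_system M B) i"
  then have "(i, j) \<in> {(x, y). {x, y} \<in> pairs (fst (restrict_system M B)) \<union>
      pairs (snd (restrict_system M B))}\<^sup>*" by (simp add: component_def)
  then show "j \<in> insert i B"
    by induction (auto simp: restrict_system_def pairs_restrict)
qed

lemma pred_relabel:
  fixes c :: "int \<Rightarrow> int + int"
  shows "Measurable.pred fair_words
    (\<lambda>w. matching_of_word {0..<int n} (relabel S (w \<circ> c)) = m)"
proof (rule pred_finite_dependence)
  show "finite ((\<lambda>i. c (enum S i)) ` {0..<int n})" by simp
  show "(matching_of_word {0..<int n} (relabel S (w \<circ> c)) = m) =
      (matching_of_word {0..<int n} (relabel S (w' \<circ> c)) = m)"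
    if "\<And>j. j \<in> (\<lambda>i. c (enum S i)) ` {0..<int n} \<Longrightarrow> w j = w' j" for w w'
  proof -
    have "canonical_matching {0..<int n} (relabel S (w \<circ> c)) =
        canonical_matching {0..<int n} (relabel S (w' \<circ> c))"
      using that by (intro canonical_matching_cong) (auto simp: relabel_def)
    then show ?thesis by (simp add: matching_of_word_eq)
  qed
qed

text \<open>The explored set is finite, so it can be quantified over through the countably many
  lists \<open>xs\<close>; for a fixed list the shape depends on finitely many letters.\<close>

lemma pred_has_partial_shape:
  "Measurable.pred fair_words (\<lambda>w. has_partial_shape (w \<circ> Inl) (w \<circ> Inr) P)"
proof -
  have "has_partial_shape (w \<circ> Inl) (w \<circ> Inr) P \<longleftrightarrow>
    \<not> L0 (w \<circ> Inl) (w \<circ> Inr) \<and> \<not> first_K (w \<circ> Inl) (w \<circ> Inr) = 0 \<and> (\<exists>m xs. first_K (w \<circ> Inl) (w \<circ> Inr) = m \<and>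
      (\<forall>j. j \<in> component (restrict_system (noodle_of w) {0..int m}) 0 \<longleftrightarrow> j \<in> set xs) \<and>
      matching_of_word {0..<int (card (set xs))} (relabel (set xs) (w \<circ> Inl)) = fst P \<and>
      matching_of_word {0..<int (card (set xs))} (relabel (set xs) (w \<circ> Inr)) = snd P)" for w
  proof -
    have "finite (explored_points (w \<circ> Inl) (w \<circ> Inr))"
      unfolding explored_points_def
      by (rule finite_subset[OF component_restrict_subset]) simp
    then obtain xs where "explored_points (w \<circ> Inl) (w \<circ> Inr) = set xs"
      using finite_list by metis
    then show ?thesis
      unfolding has_partial_shape_def partial_shape_def Let_def explored_points_def set_eq_iff[symmetric]
      by (cases P) auto
  qed
  then show ?thesis
    by (simp only:) (intro pred_intros_countable pred_intros_logic pred_L0 pred_first_K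
      pred_component_restrict pred_relabel measurable_const, simp_all)
qed

lemma measurable_card_component:
  "(\<lambda>w. card (component (noodle_of w) i)) \<in> measurable fair_words (count_space UNIV)"
  unfolding measurable_count_space_eq2_countable
proof safe
  fix n
  have "card (component (noodle_of w) i) = n \<longleftrightarrow>
      (\<exists>xs. card (set xs) = n \<and> (\<forall>j. j \<in> component (noodle_of w) i \<longleftrightarrow> j \<in> set xs)) \<or>
      (n = 0 \<and> \<not> (\<exists>xs. \<forall>j. j \<in> component (noodle_of w) i \<longleftrightarrow> j \<in> set xs))" for w
    unfolding set_eq_iff[symmetric] using finite_list[of "component (noodle_of w) i"]
    by (cases "finite (component (noodle_of w) i)") (auto, metis)
  moreover have "Measurable.pred fair_words (\<lambda>w.
      (\<exists>xs. card (set xs) = n \<and> (\<forall>j. j \<in> component (noodle_of w) i \<longleftrightarrow> j \<in> set xs)) \<or>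
      (n = 0 \<and> \<not> (\<exists>xs. \<forall>j. j \<in> component (noodle_of w) i \<longleftrightarrow> j \<in> set xs)))"
    by (intro pred_intros_countable pred_intros_logic pred_component measurable_const) simp_all
  ultimately show "(\<lambda>w. card (component (noodle_of w) i)) -` {n} \<inter> space fair_words \<in> sets fair_words"
    by (simp add: pred_def vimage_def)
qed simp

section \<open>Translation invariance\<close>

definition shift :: "int \<Rightarrow> (int + int \<Rightarrow> letter) \<Rightarrow> int + int \<Rightarrow> letter" where
  "shift t w = w \<circ> map_sum (\<lambda>i. i + t) (\<lambda>i. i + t)"

lemma shift_Inl: "shift t w \<circ> Inl = (\<lambda>i. (w \<circ> Inl) (i + t))"
  and shift_Inr: "shift t w \<circ> Inr = (\<lambda>i. (w \<circ> Inr) (i + t))"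
  by (auto simp: shift_def)

lemma distr_shift: "distr fair_words fair_words (shift t) = fair_words"
proof -
  have "inj (map_sum (\<lambda>i. i + t) (\<lambda>i. i + t :: int))"
    by (intro sum.inj_map) (auto simp: inj_def)
  then have "distr (PiM UNIV (\<lambda>_. measure_pmf coin)) (PiM UNIV (\<lambda>_ :: int + int. measure_pmf coin))
      (\<lambda>w. \<lambda>n\<in>UNIV. w (map_sum (\<lambda>i. i + t) (\<lambda>i. i + t) n)) = PiM UNIV (\<lambda>_. measure_pmf coin)"
    by (intro distr_PiM_reindex[of UNIV "\<lambda>_. measure_pmf coin"] prob_space_measure_pmf) auto
  then show ?thesis unfolding fair_words_def shift_def comp_def restrict_UNIV .
qed

lemma measurable_shift: "shift t \<in> measurable fair_words fair_words"
  unfolding fair_words_def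
proof (rule measurable_PiM_single')
  show "(\<lambda>w. shift t w i) \<in> measurable (PiM UNIV (\<lambda>_. measure_pmf coin)) (measure_pmf coin)" for i
    unfolding shift_def comp_def by (rule measurable_component_singleton) simp
qed (auto simp: PiE_UNIV_domain)

lemma height_shift: "height (\<lambda>i. w (i + t)) i k = height w (i + t) (k + t)"
proof -
  have eq: "{i + t..k + t} = (\<lambda>j. j + t) ` {i..k}" by simp
  show ?thesis unfolding height_def eq by (subst sum.reindex) (auto simp: inj_on_def)
qed

lemma mate_shift: "mate (\<lambda>i. w (i + t)) i k \<longleftrightarrow> mate w (i + t) (k + t)"
proof -
  have "matched (\<lambda>i. w (i + t)) i k \<longleftrightarrow> matched w (i + t) (k + t)" for i k
  proof -
    have "(\<forall>j. i + t \<le> j \<and> j < k + t \<longrightarrow> 0 < height w (i + t) j) \<longleftrightarrow>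
        (\<forall>j. i \<le> j \<and> j < k \<longrightarrow> 0 < height w (i + t) (j + t))"
    proof safe
      fix j assume *: "\<forall>j. i \<le> j \<and> j < k \<longrightarrow> 0 < height w (i + t) (j + t)" "i + t \<le> j" "j < k + t"
      then show "0 < height w (i + t) j" using *(1)[rule_format, of "j - t"] by simp
    qed auto
    then show ?thesis unfolding matched_def height_shift by simp
  qed
  then show ?thesis by (simp add: mate_def)
qed

lemma matchable_shift: "matchable (\<lambda>i. w (i + t)) \<longleftrightarrow> matchable w"
  unfolding matchable_def mate_shift by (metis diff_add_cancel)

lemma component_shift: "j \<in> component (noodle_of (shift t w)) i \<longleftrightarrow> j + t \<in> component (noodle_of w) (i + t)"
proof -
  define E where "E w = {(x, y). {x, y} \<in> pairs (fst (noodle_of w)) \<union> pairs (snd (noodle_of w))}" for w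
  have E: "(x, y) \<in> E (shift t w) \<longleftrightarrow> (x + t, y + t) \<in> E w" for x y
    by (simp only: E_def noodle_def fst_conv snd_conv case_prod_conv mem_Collect_eq Un_iff
      shift_Inl shift_Inr pairs_noodle mate_shift matchable_shift)
  have "(i + t, j + t) \<in> (E w)\<^sup>*" if "(i, j) \<in> (E (shift t w))\<^sup>*"
    using that by induction (auto simp: E intro: rtrancl_into_rtrancl)
  moreover have "(x - t, y - t) \<in> (E (shift t w))\<^sup>*" if "(x, y) \<in> (E w)\<^sup>*" for x y
    using that
  proof induction
    case (step y z)
    then have "(y - t, z - t) \<in> E (shift t w)" by (simp add: E)
    with step.IH show ?case by (rule rtrancl_into_rtrancl)
  qed simp
  from this[of "i + t" "j + t"] have "(i, j) \<in> (E (shift t w))\<^sup>*" if "(i + t, j + t) \<in> (E w)\<^sup>*"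
    using that by simp
  ultimately show ?thesis by (auto simp: component_def E_def)
qed

lemma component_shift_image: "component (noodle_of w) (i + t) = (\<lambda>j. j + t) ` component (noodle_of (shift t w)) i"
proof -
  have "j \<in> component (noodle_of w) (i + t) \<longleftrightarrow> j - t \<in> component (noodle_of (shift t w)) i" for j
    using component_shift[of "j - t" t w i] by simp
  moreover have "j \<in> (\<lambda>j. j + t) ` X \<longleftrightarrow> j - t \<in> X" for j and X :: "int set"
    by (force simp: image_iff)
  ultimately show ?thesis by (intro set_eqI) (simp only:)
qed

lemma card_component_shift:
  "card (component (noodle_of (shift t w)) i) = card (component (noodle_of w) (i + t))"
  unfolding component_shift_image by (simp add: card_image)

lemma leftmost_shift: "leftmost (noodle_of (shift t w)) i \<longleftrightarrow> leftmost (noodle_of w) (i + t)"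
  unfolding leftmost_def component_shift_image by auto

text \<open>By translation, the mass sent from \<open>0\<close> to \<open>y\<close> has the same
  expectation as that sent from \<open>- y\<close> to \<open>0\<close>. Summing over
  \<open>y\<close> and substituting \<open>x = - y\<close> gives the mass received by
  \<open>0\<close>.\<close>

lemma mass_transport:
  fixes f :: "int \<Rightarrow> int \<Rightarrow> (int + int \<Rightarrow> letter) \<Rightarrow> ennreal"
  assumes [measurable]: "\<And>x y. f x y \<in> borel_measurable fair_words"
    and inv: "\<And>x y t w. f x y (shift t w) = f (x + t) (y + t) w"
  shows "(\<integral>\<^sup>+w. \<integral>\<^sup>+y. f 0 y w \<partial>count_space UNIV \<partial>fair_words) =
    (\<integral>\<^sup>+w. \<integral>\<^sup>+x. f x 0 w \<partial>count_space UNIV \<partial>fair_words)"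
proof -
  have "(\<integral>\<^sup>+w. f 0 y w \<partial>fair_words) = (\<integral>\<^sup>+w. f (- y) 0 w \<partial>fair_words)" for y
  proof -
    have "(\<integral>\<^sup>+w. f (- y) 0 w \<partial>fair_words) = (\<integral>\<^sup>+w. f (- y) 0 w \<partial>distr fair_words fair_words (shift y))"
      by (simp add: distr_shift)
    also have "\<dots> = (\<integral>\<^sup>+w. f (- y) 0 (shift y w) \<partial>fair_words)"
      by (intro nn_integral_distr measurable_shift) (simp add: distr_shift)
    finally show ?thesis by (simp add: inv)
  qed
  then have "(\<integral>\<^sup>+y. \<integral>\<^sup>+w. f 0 y w \<partial>fair_words \<partial>count_space UNIV) =
      (\<integral>\<^sup>+y. \<integral>\<^sup>+w. f (- y) 0 w \<partial>fair_words \<partial>count_space UNIV)" by simp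
  also have "\<dots> = (\<integral>\<^sup>+x. \<integral>\<^sup>+w. f x 0 w \<partial>fair_words \<partial>count_space UNIV)"
    by (rule nn_integral_bij_count_space[of uminus])
      (auto simp: bij_betw_def inj_on_def surj_def intro: exI[of _ "- _"])
  finally show ?thesis by (simp add: nn_integral_count_space_nn_integral)
qed

section \<open>The probabilities\<close>

lemma component_self [simp]: "i \<in> component M i"
  by (simp add: component_def)

lemma component_eq:
  assumes "j \<in> component M i"
  shows "component M j = component M i"
proof -
  let ?E = "{(x, y). {x, y} \<in> pairs (fst M) \<union> pairs (snd M)}"
  have ij: "(i, j) \<in> ?E\<^sup>*" using assms by (simp add: component_def)
  have "sym (?E\<^sup>*)" by (intro sym_rtrancl symI) (auto simp: insert_commute)
  then have ji: "(j, i) \<in> ?E\<^sup>*" using ij by (rule symD)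
  show ?thesis unfolding component_def
    by (intro Collect_cong iffI) (erule rtrancl_trans[OF ij] rtrancl_trans[OF ji])+
qed

lemma card_component_eq_0: "card (component M i) = 0 \<longleftrightarrow> infinite (component M i)"
  using component_self[of i M] by (auto simp: card_eq_0_iff simp del: component_self)

lemma ex_leftmost:
  assumes "finite (component M i)"
  shows "\<exists>x. leftmost M x \<and> i \<in> component M x"
proof -
  have ne: "component M i \<noteq> {}" using component_self by blast
  let ?x = "Min (component M i)"
  have x: "?x \<in> component M i" using assms ne by simp
  then have "component M ?x = component M i" by (rule component_eq)
  then show ?thesis using assms by (intro exI[of _ ?x]) (simp add: leftmost_def)
qed

text \<open>Every point sends mass \<open>\<phi> |C|\<close> to all points of its component \<open>C\<close> if it is the leftmost point
  of \<open>C\<close>.\<close>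

lemma leftmost_transport:
  fixes \<phi> :: "nat \<Rightarrow> ennreal"
  shows "(\<integral>\<^sup>+w. (if leftmost (noodle_of w) 0 then
        \<phi> (card (component (noodle_of w) 0)) * emeasure (count_space UNIV) (component (noodle_of w) 0) else 0)
      \<partial>fair_words) =
    (\<integral>\<^sup>+w. (if \<exists>x. leftmost (noodle_of w) x \<and> 0 \<in> component (noodle_of w) x
      then \<phi> (card (component (noodle_of w) 0)) else 0) \<partial>fair_words)"
proof -
  define f where "f x y w = (if leftmost (noodle_of w) x \<and> y \<in> component (noodle_of w) x
    then \<phi> (card (component (noodle_of w) x)) else 0)" for x y w
  have "f x y \<in> borel_measurable fair_words" for x y
    unfolding f_def
  proof (rule measurable_If)
    show "(\<lambda>w. \<phi> (card (component (noodle_of w) x))) \<in> borel_measurable fair_words"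
      by (rule measurable_compose[OF measurable_card_component]) simp
    show "{w \<in> space fair_words. leftmost (noodle_of w) x \<and> y \<in> component (noodle_of w) x} \<in> sets fair_words"
      using pred_leftmost pred_component by (intro predE pred_intros_logic)
  qed simp
  moreover have "f x y (shift t w) = f (x + t) (y + t) w" for x y t w
    by (simp add: f_def leftmost_shift component_shift card_component_shift)
  ultimately have "(\<integral>\<^sup>+w. \<integral>\<^sup>+y. f 0 y w \<partial>count_space UNIV \<partial>fair_words) =
    (\<integral>\<^sup>+w. \<integral>\<^sup>+x. f x 0 w \<partial>count_space UNIV \<partial>fair_words)"
    by (rule mass_transport)
  moreover have "(\<integral>\<^sup>+y. f 0 y w \<partial>count_space UNIV) = (if leftmost (noodle_of w) 0 then
      \<phi> (card (component (noodle_of w) 0)) * emeasure (count_space UNIV) (component (noodle_of w) 0) else 0)" for w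
  proof (cases "leftmost (noodle_of w) 0")
    case True
    have "f 0 y w = \<phi> (card (component (noodle_of w) 0)) * indicator (component (noodle_of w) 0) y" for y
      using True by (simp add: f_def)
    then show ?thesis using True by (simp add: nn_integral_cmult_indicator)
  next
    case False
    then show ?thesis by (simp add: f_def)
  qed
  moreover have "(\<integral>\<^sup>+x. f x 0 w \<partial>count_space UNIV) =
      (if \<exists>x. leftmost (noodle_of w) x \<and> 0 \<in> component (noodle_of w) x
       then \<phi> (card (component (noodle_of w) 0)) else 0)" for w
  proof (cases "\<exists>x. leftmost (noodle_of w) x \<and> 0 \<in> component (noodle_of w) x")
    case True
    then obtain x where x: "leftmost (noodle_of w) x" "0 \<in> component (noodle_of w) x" by blast
    \<comment> \<open>A component has at most one leftmost point, so \<open>0\<close> receives mass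
      from a single sender.\<close>
    have unique: "y = x" if "leftmost (noodle_of w) y" "0 \<in> component (noodle_of w) y" for y
    proof -
      have "component (noodle_of w) x = component (noodle_of w) y"
        using component_eq[OF x(2)] component_eq[OF that(2)] by simp
      then have "x \<in> component (noodle_of w) y" "y \<in> component (noodle_of w) x"
        using component_self[of _ "noodle_of w"] by blast+
      then show ?thesis using x(1) that(1) unfolding leftmost_def by force
    qed
    have "f y 0 w = \<phi> (card (component (noodle_of w) 0)) * indicator {x} y" for y
    proof (cases "y = x")
      case True
      have "f x 0 w = \<phi> (card (component (noodle_of w) 0))"
        unfolding f_def component_eq[OF x(2)] using x by (simp only: simp_thms if_True)
      then show ?thesis using True by simp
    next
      case False
      then have "f y 0 w = 0" unfolding f_def using unique by (intro if_not_P) blast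
      then show ?thesis using False by simp
    qed
    then show ?thesis using True by (simp add: nn_integral_cmult_indicator)
  next
    case False
    then have "f x 0 w = 0" for x by (auto simp: f_def)
    then show ?thesis unfolding if_not_P[OF False] by simp
  qed
  ultimately show ?thesis by simp
qed

lemma pred_infinite_component: "Measurable.pred fair_words (\<lambda>w. infinite (component (noodle_of w) i))"
  unfolding card_component_eq_0[symmetric]
  using measurable_card_component[of i] by measurable

text \<open>Take \<open>\<phi>\<close> to be 1 on infinite components, recognised by cardinality
  \<open>0\<close>, and 0 on finite ones. Then \<open>0\<close> would send infinite mass on an event
  of positive probability, but it receives at most 1.\<close>

lemma emeasure_leftmost_infinite:
  "emeasure fair_words {w. leftmost (noodle_of w) 0 \<and> infinite (component (noodle_of w) 0)} = 0"
    (is "emeasure _ ?X = 0")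
proof (rule ccontr)
  interpret prob_space fair_words by (rule prob_space_fair_words)
  let ?\<phi> = "\<lambda>n :: nat. if n = 0 then 1 else 0 :: ennreal"
  assume "emeasure fair_words ?X \<noteq> 0"
  have "Measurable.pred fair_words (\<lambda>w. leftmost (noodle_of w) 0 \<and> infinite (component (noodle_of w) 0))"
    by (intro pred_intros_logic pred_leftmost pred_infinite_component)
  then have X: "?X \<in> sets fair_words" by (simp add: pred_def)
  have "\<top> * emeasure fair_words ?X = (\<integral>\<^sup>+w. \<top> * indicator ?X w \<partial>fair_words)"
    using X by (rule nn_integral_cmult_indicator[symmetric])
  also have "\<dots> = (\<integral>\<^sup>+w. (if leftmost (noodle_of w) 0 then ?\<phi> (card (component (noodle_of w) 0)) *
      emeasure (count_space UNIV) (component (noodle_of w) 0) else 0) \<partial>fair_words)"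
    unfolding card_component_eq_0 by (intro nn_integral_cong) (auto simp: indicator_def)
  also have "\<dots> = (\<integral>\<^sup>+w. (if \<exists>x. leftmost (noodle_of w) x \<and> 0 \<in> component (noodle_of w) x
      then ?\<phi> (card (component (noodle_of w) 0)) else 0) \<partial>fair_words)"
    by (rule leftmost_transport)
  also have "\<dots> \<le> (\<integral>\<^sup>+w. 1 \<partial>fair_words)" by (intro nn_integral_mono) auto
  also have "\<dots> = 1" by (simp add: emeasure_space_1[simplified])
  finally show False using \<open>emeasure fair_words ?X \<noteq> 0\<close> by (simp add: ennreal_top_mult top_unique)
qed

text \<open>With \<open>\<phi> n = 1 / n\<close>, the leftmost point of a finite component sends
  total mass 1, and \<open>0\<close> receives the inverse size of its component. Infinite components
  drop out on both sides because \<open>1 / 0 = 0\<close>; their share of \<open>L0\<close> is a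
  null event.\<close>

lemma prob_L0:
  "measure fair_words {w. L0 (w \<circ> Inl) (w \<circ> Inr)} =
    (LINT w|fair_words. 1 / real (card (component (noodle_of w) 0)))"
proof -
  interpret prob_space fair_words by (rule prob_space_fair_words)
  let ?\<phi> = "\<lambda>n. ennreal (1 / real n)"
  let ?X = "{w. L0 (w \<circ> Inl) (w \<circ> Inr) \<and> finite (component (noodle_of w) 0)}"
  let ?Y = "{w. leftmost (noodle_of w) 0 \<and> infinite (component (noodle_of w) 0)}"
  have "Measurable.pred fair_words (\<lambda>w. L0 (w \<circ> Inl) (w \<circ> Inr) \<and> \<not> infinite (component (noodle_of w) 0))"
    by (intro pred_intros_logic pred_L0 pred_infinite_component)
  then have X: "?X \<in> sets fair_words" by (simp add: pred_def)
  have "Measurable.pred fair_words (\<lambda>w. leftmost (noodle_of w) 0 \<and> infinite (component (noodle_of w) 0))"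
    by (intro pred_intros_logic pred_leftmost pred_infinite_component)
  then have Y: "?Y \<in> sets fair_words" by (simp add: pred_def)
  have "emeasure fair_words ?X = (\<integral>\<^sup>+w. indicator ?X w \<partial>fair_words)" using X by simp
  also have "\<dots> = (\<integral>\<^sup>+w. (if leftmost (noodle_of w) 0 then ?\<phi> (card (component (noodle_of w) 0)) *
      emeasure (count_space UNIV) (component (noodle_of w) 0) else 0) \<partial>fair_words)"
  proof (intro nn_integral_cong)
    fix w
    show "indicator ?X w = (if leftmost (noodle_of w) 0 then ?\<phi> (card (component (noodle_of w) 0)) *
      emeasure (count_space UNIV) (component (noodle_of w) 0) else 0)"
    proof (cases "finite (component (noodle_of w) 0)")
      case True
      have "component (noodle_of w) 0 \<noteq> {}" using component_self by blast
      then have "?\<phi> (card (component (noodle_of w) 0)) *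
          emeasure (count_space UNIV) (component (noodle_of w) 0) = 1"
        using True by (simp add: ennreal_of_nat_eq_real_of_nat ennreal_mult[symmetric])
      then show ?thesis using True by (simp add: L0_def)
    next
      case False
      then show ?thesis by simp
    qed
  qed
  also have "\<dots> = (\<integral>\<^sup>+w. (if \<exists>x. leftmost (noodle_of w) x \<and> 0 \<in> component (noodle_of w) x
      then ?\<phi> (card (component (noodle_of w) 0)) else 0) \<partial>fair_words)"
    by (rule leftmost_transport)
  also have "\<dots> = (\<integral>\<^sup>+w. ?\<phi> (card (component (noodle_of w) 0)) \<partial>fair_words)"
  proof (intro nn_integral_cong)
    fix w
    show "(if \<exists>x. leftmost (noodle_of w) x \<and> 0 \<in> component (noodle_of w) x
      then ?\<phi> (card (component (noodle_of w) 0)) else 0) = ?\<phi> (card (component (noodle_of w) 0))"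
      using ex_leftmost[of "noodle_of w" 0]
      by (cases "finite (component (noodle_of w) 0)") auto
  qed
  finally have "measure fair_words ?X = enn2real (\<integral>\<^sup>+w. ?\<phi> (card (component (noodle_of w) 0)) \<partial>fair_words)"
    by (simp add: measure_def)
  also have "\<dots> = (LINT w|fair_words. 1 / real (card (component (noodle_of w) 0)))"
    by (rule integral_eq_nn_integral[symmetric])
      (auto intro!: measurable_compose[OF measurable_card_component])
  finally have "measure fair_words ?X = (LINT w|fair_words. 1 / real (card (component (noodle_of w) 0)))" .
  moreover have "{w. L0 (w \<circ> Inl) (w \<circ> Inr)} = ?X \<union> ?Y" by (auto simp: L0_def)
  moreover have "measure fair_words (?X \<union> ?Y) = measure fair_words ?X + measure fair_words ?Y"
    using X Y by (intro finite_measure_Union) auto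
  moreover have "measure fair_words ?Y = 0" by (simp add: measure_def emeasure_leftmost_infinite)
  ultimately show ?thesis by simp
qed

lemma prob_R_at_0: "measure fair_words {w. w (Inl 0) = R \<or> w (Inr 0) = R} = 3 / 4"
proof -
  interpret prob_space fair_words by (rule prob_space_fair_words)
  let ?B = "{w. \<forall>j\<in>{Inl 0, Inr 0}. w j = L}"
  have "Measurable.pred fair_words (\<lambda>w. \<forall>j\<in>{Inl 0, Inr 0}. w j = L)"
    by (intro pred_intros_finite pred_letter) simp
  then have "?B \<in> sets fair_words" by (simp add: pred_def)
  then have "prob (space fair_words - ?B) = 1 - prob ?B" by (rule prob_compl)
  moreover have "prob ?B = 1 / 4"
    using prob_cylinder[of "{Inl 0, Inr 0}" "\<lambda>_. L"] by (simp add: power2_eq_square)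
  moreover have "space fair_words - ?B = {w. w (Inl 0) = R \<or> w (Inr 0) = R}" by auto
  ultimately show ?thesis by simp
qed

lemma AE_matchable_words: "AE w in fair_words. matchable_words (w \<circ> Inl) (w \<circ> Inr)"
  using AE_matchable[OF inj_Inl] AE_matchable[OF inj_Inr]
  by eventually_elim (simp add: matchable_words_def)

lemma has_sum_partial_shapes:
  "((\<lambda>k. \<Sum>P\<in>partial_shapes k. measure fair_words {w. has_partial_shape (w \<circ> Inl) (w \<circ> Inr) P})
    has_sum (measure fair_words {w. \<not> L0 (w \<circ> Inl) (w \<circ> Inr)} - 3 / 4)) {1..}"
proof -
  interpret prob_space fair_words by (rule prob_space_fair_words)
  let ?L0 = "\<lambda>w. L0 (w \<circ> Inl) (w \<circ> Inr)" and ?K = "\<lambda>w. first_K (w \<circ> Inl) (w \<circ> Inr)"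
  let ?H = "\<lambda>P. {w. has_partial_shape (w \<circ> Inl) (w \<circ> Inr) P}"
  \<comment> \<open>The empty set at \<open>k = 0\<close> lets countable additivity run over all
    natural numbers while the sum starts at 1.\<close>
  define A where "A k = (if 1 \<le> k then \<Union>P\<in>partial_shapes k. ?H P else {})" for k
  have H: "?H P \<in> sets fair_words" for P using pred_has_partial_shape[of P] by (simp add: pred_def)
  have A: "A k \<in> sets fair_words" for k
    unfolding A_def using H finite_partial_shapes by auto
  have probA: "prob (A k) = (\<Sum>P\<in>partial_shapes k. prob (?H P))" if "1 \<le> k" for k
    unfolding A_def using that H finite_partial_shapes
    by (simp, intro finite_measure_finite_Union)
      (auto simp: disjoint_family_on_def has_partial_shape_def)
  have "disjoint_family A"
    unfolding disjoint_family_on_def A_def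
    by (auto simp: has_partial_shape_def dest: partial_shapes_disjoint)
  then have "(\<lambda>k. prob (A k)) sums prob (\<Union>k. A k)"
    using A by (intro finite_measure_UNION) auto
  then have "((\<lambda>k. prob (A k)) has_sum prob (\<Union>k. A k)) UNIV"
    by (intro sums_nonneg_imp_has_sum) auto
  moreover have "((\<lambda>k. \<Sum>P\<in>partial_shapes k. prob (?H P)) has_sum s) {1..} \<longleftrightarrow>
      ((\<lambda>k. prob (A k)) has_sum s) UNIV" for s
    using probA by (intro has_sum_cong_neutral) (auto simp: A_def)
  ultimately have sum: "((\<lambda>k. \<Sum>P\<in>partial_shapes k. prob (?H P)) has_sum prob (\<Union>k. A k)) {1..}"
    by blast
  have B: "{w. \<not> ?L0 w \<and> ?K w = 0} \<in> sets fair_words"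
  proof -
    have "Measurable.pred fair_words (\<lambda>w. \<not> ?L0 w \<and> ?K w = 0)"
      by (intro pred_intros_logic pred_L0 pred_first_K)
    then show ?thesis by (simp add: pred_def)
  qed
  have U: "{w. \<not> ?L0 w \<and> \<not> ?K w = 0} \<in> sets fair_words"
  proof -
    have "Measurable.pred fair_words (\<lambda>w. \<not> ?L0 w \<and> \<not> ?K w = 0)"
      by (intro pred_intros_logic pred_L0 pred_first_K)
    then show ?thesis by (simp add: pred_def)
  qed
  have "{w. \<not> ?L0 w} = {w. \<not> ?L0 w \<and> ?K w = 0} \<union> {w. \<not> ?L0 w \<and> \<not> ?K w = 0}" by auto
  moreover have "prob ({w. \<not> ?L0 w \<and> ?K w = 0} \<union> {w. \<not> ?L0 w \<and> \<not> ?K w = 0}) =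
      prob {w. \<not> ?L0 w \<and> ?K w = 0} + prob {w. \<not> ?L0 w \<and> \<not> ?K w = 0}"
    using B U by (intro finite_measure_Union) auto
  \<comment> \<open>The two events agree only almost surely: a word that is not matchable has a
    noodle matching without arcs, whatever its letter at \<open>0\<close>.\<close>
  moreover have "prob {w. \<not> ?L0 w \<and> ?K w = 0} = prob {w. w (Inl 0) = R \<or> w (Inr 0) = R}"
  proof (rule finite_measure_eq_AE)
    have "Measurable.pred fair_words (\<lambda>w. w (Inl 0) = R \<or> w (Inr 0) = R)"
      by (intro pred_intros_logic pred_letter)
    then show "{w. w (Inl 0) = R \<or> w (Inr 0) = R} \<in> sets fair_words" by (simp add: pred_def)
    show "AE w in fair_words. w \<in> {w. \<not> ?L0 w \<and> ?K w = 0} \<longleftrightarrow> w \<in> {w. w (Inl 0) = R \<or> w (Inr 0) = R}"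
      using AE_matchable_words
      by eventually_elim (simp add: matchable_words.first_K_0_iff)
  qed (rule B)
  moreover have "prob {w. \<not> ?L0 w \<and> \<not> ?K w = 0} = prob (\<Union>k. A k)"
  proof (rule finite_measure_eq_AE)
    show "AE w in fair_words. w \<in> {w. \<not> ?L0 w \<and> \<not> ?K w = 0} \<longleftrightarrow> w \<in> (\<Union>k. A k)"
      using AE_matchable_words
    proof eventually_elim
      case (elim w)
      have "\<exists>k\<ge>1. partial_shape (w \<circ> Inl) (w \<circ> Inr) \<in> partial_shapes k" if "\<not> ?L0 w" "1 \<le> ?K w"
        using matchable_words.partial_shape_in_partial_shapes[OF elim that] .
      then show ?case by (auto simp: A_def has_partial_shape_def Suc_le_eq split: if_splits)
    qed
  qed (use A U in auto)
  ultimately have "prob {w. \<not> ?L0 w} = 3 / 4 + prob (\<Union>k. A k)" using prob_R_at_0 by simp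
  then show ?thesis using sum by simp
qed

section \<open>Transfer from the product space to the given words\<close>

lemma distr_iid_uniform_words:
  assumes "prob_space M" "iid_uniform_words M wa wb"
  shows "(\<lambda>\<omega>. case_sum (wa \<omega>) (wb \<omega>)) \<in> measurable M fair_words"
    and "distr M fair_words (\<lambda>\<omega>. case_sum (wa \<omega>) (wb \<omega>)) = fair_words"
proof -
  interpret prob_space M by fact
  let ?X = "case_sum (\<lambda>i \<omega>. wa \<omega> i) (\<lambda>i \<omega>. wb \<omega> i)"
  let ?\<Phi> = "\<lambda>\<omega>. case_sum (wa \<omega>) (wb \<omega>)"
  have indep: "indep_vars (\<lambda>_. count_space UNIV) ?X UNIV"
    and half: "\<And>i l. \<P>(\<omega> in M. wa \<omega> i = l) = 1 / 2 \<and> \<P>(\<omega> in M. wb \<omega> i = l) = 1 / 2"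
    using assms(2) by (auto simp: iid_uniform_words_def)
  have rv: "?X j \<in> measurable M (count_space UNIV)" for j
    using indep by (simp add: indep_vars_def)
  have \<Phi>: "(\<lambda>\<omega>. \<lambda>j\<in>UNIV. ?X j \<omega>) = ?\<Phi>" by (auto simp: fun_eq_iff split: sum.split)
  have sets: "sets (PiM UNIV (\<lambda>_ :: int + int. count_space UNIV)) = sets fair_words"
    unfolding fair_words_def by (intro sets_PiM_cong) auto
  have distr: "distr M (count_space UNIV) (?X j) = measure_pmf coin" for j
  proof (rule measure_eqI_finite[of _ UNIV])
    fix l :: letter
    have "emeasure (distr M (count_space UNIV) (?X j)) {l} = emeasure M (?X j -` {l} \<inter> space M)"
      using rv by (rule emeasure_distr) simp
    also have "?X j -` {l} \<inter> space M = {\<omega> \<in> space M. ?X j \<omega> = l}" by auto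
    also have "emeasure M \<dots> = ennreal (1 / 2)"
      unfolding emeasure_eq_measure by (cases j) (simp_all only: sum.case half)
    also have "\<dots> = emeasure (measure_pmf coin) {l}"
      by (metis measure_coin measure_pmf.emeasure_eq_measure)
    finally show "emeasure (distr M (count_space UNIV) (?X j)) {l} = emeasure (measure_pmf coin) {l}" .
  qed (auto simp: finite_letters)
  have "distr M (PiM UNIV (\<lambda>_. count_space UNIV)) (\<lambda>\<omega>. \<lambda>j\<in>UNIV. ?X j \<omega>) =
      PiM UNIV (\<lambda>j. distr M (count_space UNIV) (?X j))"
    using indep_vars_iff_distr_eq_PiM[of UNIV ?X "\<lambda>_. count_space UNIV"] rv indep by simp
  then have "distr M (PiM UNIV (\<lambda>_. count_space UNIV)) ?\<Phi> = fair_words"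
    unfolding \<Phi> distr fair_words_def .
  moreover have "distr M fair_words ?\<Phi> = distr M (PiM UNIV (\<lambda>_. count_space UNIV)) ?\<Phi>"
    using sets by (intro distr_cong) auto
  ultimately show "distr M fair_words ?\<Phi> = fair_words" by simp
  have "?\<Phi> \<in> measurable M (PiM UNIV (\<lambda>_. count_space UNIV))"
    unfolding \<Phi>[symmetric] using rv by (intro measurable_restrict)
  then show "?\<Phi> \<in> measurable M fair_words" using sets by (simp cong: measurable_cong_sets)
qed

theorem proposition14:
  fixes M :: "'a measure" and wa wb :: "'a \<Rightarrow> int \<Rightarrow> letter"
  assumes "prob_space M"
    and "iid_uniform_words M wa wb"
  shows "1 - kappa M wa wb / 2 = \<P>(\<omega> in M. \<not> L0 (wa \<omega>) (wb \<omega>)) \<and>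
    (\<lambda>k. \<Sum>P\<in>partial_shapes k. \<P>(\<omega> in M. has_partial_shape (wa \<omega>) (wb \<omega>) P))
      summable_on {1..} \<and>
    \<P>(\<omega> in M. \<not> L0 (wa \<omega>) (wb \<omega>)) =
      3 / 4 + (\<Sum>\<^sub>\<infinity>k\<in>{1..}. \<Sum>P\<in>partial_shapes k.
        \<P>(\<omega> in M. has_partial_shape (wa \<omega>) (wb \<omega>) P))"
proof -
  interpret prob_space M by fact
  interpret N: prob_space fair_words by (rule prob_space_fair_words)
  let ?\<Phi> = "\<lambda>\<omega>. case_sum (wa \<omega>) (wb \<omega>)"
  note \<Phi> = distr_iid_uniform_words[OF assms]
  have proj: "?\<Phi> \<omega> \<circ> Inl = wa \<omega>" "?\<Phi> \<omega> \<circ> Inr = wb \<omega>" for \<omega> by (auto simp: fun_eq_iff)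
  have transfer: "\<P>(\<omega> in M. Q (wa \<omega>) (wb \<omega>)) = measure fair_words {w. Q (w \<circ> Inl) (w \<circ> Inr)}"
    if "Measurable.pred fair_words (\<lambda>w. Q (w \<circ> Inl) (w \<circ> Inr))" for Q
  proof -
    have "measure fair_words {w. Q (w \<circ> Inl) (w \<circ> Inr)} =
        measure (distr M fair_words ?\<Phi>) {w. Q (w \<circ> Inl) (w \<circ> Inr)}" by (simp only: \<Phi>(2))
    also have "\<dots> = measure M (?\<Phi> -` {w. Q (w \<circ> Inl) (w \<circ> Inr)} \<inter> space M)"
      using that by (intro measure_distr \<Phi>(1)) (simp add: pred_def)
    also have "?\<Phi> -` {w. Q (w \<circ> Inl) (w \<circ> Inr)} \<inter> space M = {\<omega> \<in> space M. Q (wa \<omega>) (wb \<omega>)}"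
      by (auto simp: proj)
    finally show ?thesis by (rule sym)
  qed
  \<comment> \<open>The case distinction in \<open>kappa\<close> disappears: an infinite component
    has cardinality \<open>0\<close>, and dividing by it gives 0.\<close>
  have "kappa M wa wb = (LINT \<omega>|M. 2 * (1 / real (card (component (noodle_of (?\<Phi> \<omega>)) 0))))"
    unfolding kappa_def Let_def proj by (intro Bochner_Integration.integral_cong) auto
  also have "\<dots> = 2 * (LINT \<omega>|M. 1 / real (card (component (noodle_of (?\<Phi> \<omega>)) 0)))"
    by (rule integral_mult_right_zero)
  also have "(LINT \<omega>|M. 1 / real (card (component (noodle_of (?\<Phi> \<omega>)) 0))) =
      (LINT w|distr M fair_words ?\<Phi>. 1 / real (card (component (noodle_of w) 0)))"
    by (rule integral_distr[symmetric, OF \<Phi>(1)])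
      (auto intro!: measurable_compose[OF measurable_card_component])
  finally have kappa: "kappa M wa wb = 2 * measure fair_words {w. L0 (w \<circ> Inl) (w \<circ> Inr)}"
    by (simp only: \<Phi>(2) prob_L0)
  have not_L0: "\<P>(\<omega> in M. \<not> L0 (wa \<omega>) (wb \<omega>)) = measure fair_words {w. \<not> L0 (w \<circ> Inl) (w \<circ> Inr)}"
    by (intro transfer pred_intros_logic pred_L0)
  have "{w. \<not> L0 (w \<circ> Inl) (w \<circ> Inr)} = space fair_words - {w. L0 (w \<circ> Inl) (w \<circ> Inr)}" by auto
  moreover have "{w. L0 (w \<circ> Inl) (w \<circ> Inr)} \<in> sets fair_words" using pred_L0 by (simp add: pred_def)
  ultimately have compl: "measure fair_words {w. \<not> L0 (w \<circ> Inl) (w \<circ> Inr)} =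
      1 - measure fair_words {w. L0 (w \<circ> Inl) (w \<circ> Inr)}"
    using N.prob_compl by simp
  have shapes: "\<P>(\<omega> in M. has_partial_shape (wa \<omega>) (wb \<omega>) P) =
      measure fair_words {w. has_partial_shape (w \<circ> Inl) (w \<circ> Inr) P}" for P
    by (intro transfer pred_has_partial_shape)
  have "((\<lambda>k. \<Sum>P\<in>partial_shapes k. \<P>(\<omega> in M. has_partial_shape (wa \<omega>) (wb \<omega>) P))
      has_sum (\<P>(\<omega> in M. \<not> L0 (wa \<omega>) (wb \<omega>)) - 3 / 4)) {1..}"
    unfolding shapes not_L0 by (rule has_sum_partial_shapes)
  then show ?thesis
    using kappa not_L0 compl by (auto simp: has_sum_imp_summable dest!: infsumI)
qed

end
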